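(* Let $X_k,Y_k\in\mathbb R^{m\times n}$ ($k=1,\dots,p$, $X_{p+1}=X_1$) be the solution of the PGCS equation $A_kX_k-Y_kB_k=E_k$, $C_kX_{k+1}-Y_kD_k=F_k$ ($k=1,\dots,p$), whose coefficient matrix $W$ (defined in the context) is nonsingular. Let $\Delta A_k,\Delta C_k\in\mathbb R^{m\times m}$, $\Delta B_k,\Delta D_k\in\mathbb R^{n\times n}$, $\Delta E_k,\Delta F_k\in\mathbb R^{m\times n}$ be perturbations, and consider the perturbed PGCS equation $$(A_k+\Delta A_k)(X_k+\Delta X_k)-(Y_k+\Delta Y_k)(B_k+\Delta B_k)=E_k+\Delta E_k,$$ $$(C_k+\Delta C_k)(X_{k+1}+\Delta X_{k+1})-(Y_k+\Delta Y_k)(D_k+\Delta D_k)=F_k+\Delta F_k,\qquad k=1,\dots,p,$$ in the unknowns $\Delta X_k,\Delta Y_k\in\mathbb R^{m\times n}$ ($k=1,\dots,p$), with $\Delta X_{p+1}=\Delta X_1$. Let $\alpha_k,\beta_k,\gamma_k,\zeta_k,\tau_k,\delta_k>0$ be given tolerances. If $\|W^{-1}\Delta W\|_2<1$, then the perturbed PGCS equation has a unique solution, and $$\|[\Delta X_1,\Delta Y_1,\dots,\Delta X_p,\Delta Y_p]\|_F\le\frac{\|W^{-1}H_1u\|_2}{1-\|W^{-1}\Delta W\|_2}$$ $$\le\frac{\|W^{-1}H_1\|_2\left(\sum_{i=1}^p\left(\frac{\|\Delta A_i\|_F^2}{\alpha_i^2}+\frac{\|\Delta B_i\|_F^2}{\beta_i^2}+\frac{\|\Delta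 E_i\|_F^2}{\gamma_i^2}+\frac{\|\Delta C_i\|_F^2}{\zeta_i^2}+\frac{\|\Delta D_i\|_F^2}{\tau_i^2}+\frac{\|\Delta F_i\|_F^2}{\delta_i^2}\right)\right)^{1/2}}{1-\|W^{-1}\Delta W\|_2},$$ and $$\|[\Delta X_1,\Delta Y_1,\dots,\Delta X_p,\Delta Y_p]\|_F\le\frac{\sqrt{6p}\,\|W^{-1}H_1\|_2\,\epsilon}{1-\|W^{-1}\Delta W\|_2},$$ where $$\epsilon=\max_{1\le k\le p}\max\left\{\frac{\|\Delta A_k\|_F}{\alpha_k},\frac{\|\Delta B_k\|_F}{\beta_k},\frac{\|\Delta E_k\|_F}{\gamma_k},\frac{\|\Delta C_k\|_F}{\zeta_k},\frac{\|\Delta D_k\|_F}{\tau_k},\frac{\|\Delta F_k\|_F}{\delta_k}\right\}.$$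
   Context: Setting: $p,m,n\ge1$ are integers; $A_k,C_k\in\mathbb R^{m\times m}$, $B_k,D_k\in\mathbb R^{n\times n}$, $E_k,F_k\in\mathbb R^{m\times n}$ ($k=1,\dots,p$) are given. $\otimes$ is the Kronecker product, $\mathrm{vec}$ stacks the columns of a matrix one underneath the other, $I$ is an identity matrix of appropriate order, $\|\cdot\|_2$ is the spectral norm (Euclidean norm for vectors), $\|\cdot\|_F$ the Frobenius norm. The PGCS equation is equivalent to $Wz=g$ with $z=\mathrm{vec}([X_1,Y_1,\dots,X_p,Y_p])$, $g=\mathrm{vec}([E_1,F_1,\dots,E_p,F_p])$, where $W\in\mathbb R^{2pmn\times 2pmn}$ is the matrix of the linear map sending $\mathrm{vec}([X_1,Y_1,\dots,X_p,Y_p])$ to $\mathrm{vec}([A_1X_1-Y_1B_1,\ C_1X_2-Y_1D_1,\ \dots,\ A_pX_p-Y_pB_p,\ C_pX_1-Y_pD_p])$. That is, in $mn\times mn$ blocks, block row $2k-1$ has $I\otimes A_k$ in the column of $X_k$ and $-(B_k^T\otimes I)$ in the column of $Y_k$; block row $2k$ has $-(D_k^T\otimes I)$ in the column of $Y_k$ and $I\otimes C_k$ in the column of $X_{k+1}$ (with $X_{p+1}=X_1$); all other blocks are zero. $\Delta W$ is the same matrix as $W$ with $A_k,B_k,C_k,D_k$ replaced by $\Delta A_k,\Delta B_k,\Delta C_k,\Delta D_k$. $H_1=\mathrm{diag}(H_{1,1},\dots,H_{1,p})$ is block diagonal with $$H_{1,k}=\begin{bmatrix}\alpha_k(X_k^T\otimes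 I)&-\beta_k(I\otimes Y_k)&-\gamma_kI&0&0&0\\0&0&0&\zeta_k(X_{k+1}^T\otimes I)&-\tau_k(I\otimes Y_k)&-\delta_kI\end{bmatrix},$$ and $u$ is the column vector obtained by stacking, for $k=1,\dots,p$ in order, the vectors $\mathrm{vec}(\Delta A_k)/\alpha_k$, $\mathrm{vec}(\Delta B_k)/\beta_k$, $\mathrm{vec}(\Delta E_k)/\gamma_k$, $\mathrm{vec}(\Delta C_k)/\zeta_k$, $\mathrm{vec}(\Delta D_k)/\tau_k$, $\mathrm{vec}(\Delta F_k)/\delta_k$. *)

theory Defs
  imports
    "HOL-Analysis.L2_Norm"
    "HOL-Library.FuncSet"
    "Jordan_Normal_Form.Gauss_Jordan_Elimination"
begin

definition vec_norm2 :: "real vec \<Rightarrow> real" where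
  "vec_norm2 v = L2_set (\<lambda>i. v $ i) {..<dim_vec v}"

definition frob_norm :: "real mat \<Rightarrow> real" where
  "frob_norm A = L2_set (\<lambda>(i, j). A $$ (i, j)) ({..<dim_row A} \<times> {..<dim_col A})"

text \<open>The spectral norm is the operator norm induced by the Euclidean norm, written as
  the library's \<open>onorm\<close> is; the zero vector contributes the value \<open>0 / 0 = 0\<close>.\<close>

definition spec_norm :: "real mat \<Rightarrow> real" where
  "spec_norm A = (SUP x \<in> carrier_vec (dim_col A). vec_norm2 (A *\<^sub>v x) / vec_norm2 x)"

definition kron :: "'a::times mat \<Rightarrow> 'a mat \<Rightarrow> 'a mat" where
  "kron A B = mat (dim_row A * dim_row B) (dim_col A * dim_col B)
     (\<lambda>(i, j). A $$ (i div dim_row B, j div dim_col B) * B $$ (i mod dim_row B, j mod dim_col B))"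

definition vectorize :: "'a mat \<Rightarrow> 'a vec" where
  "vectorize A = vec (dim_row A * dim_col A) (\<lambda>i. A $$ (i mod dim_row A, i div dim_row A))"

definition append_cols :: "'a::zero mat \<Rightarrow> 'a mat \<Rightarrow> 'a mat" where
  "append_cols A B = four_block_mat A B (0\<^sub>m 0 (dim_col A)) (0\<^sub>m 0 (dim_col B))"

text \<open>The first argument of \<open>hcat\<close> is the common number of rows and that of \<open>vcat\<close> the common
  number of columns; it fixes the shape of the empty concatenation.\<close>

definition hcat :: "nat \<Rightarrow> 'a::zero mat list \<Rightarrow> 'a mat" where
  "hcat nr As = foldr append_cols As (0\<^sub>m nr 0)"

definition vcat :: "nat \<Rightarrow> 'a::zero mat list \<Rightarrow> 'a mat" where
  "vcat nc As = foldr (@\<^sub>r) As (0\<^sub>m 0 nc)"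

definition vec_concat :: "'a vec list \<Rightarrow> 'a vec" where
  "vec_concat vs = foldr (@\<^sub>v) vs vNil"

text \<open>All families are indexed by \<open>1, \<dots>, p\<close>; their values outside this range play no role.
  Since the index is cyclic (\<open>X\<^sub>p\<^sub>+\<^sub>1 = X\<^sub>1\<close>), the index \<open>k + 1\<close> of an \<open>X\<close> is rendered by
  \<open>cyc_suc p k\<close>.\<close>

definition cyc_suc :: "nat \<Rightarrow> nat \<Rightarrow> nat" where
  "cyc_suc p k = (if k = p then 1 else k + 1)"

definition pgcs_eq ::
  "nat \<Rightarrow> (nat \<Rightarrow> real mat) \<Rightarrow> (nat \<Rightarrow> real mat) \<Rightarrow> (nat \<Rightarrow> real mat) \<Rightarrow> (nat \<Rightarrow> real mat) \<Rightarrow>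
   (nat \<Rightarrow> real mat) \<Rightarrow> (nat \<Rightarrow> real mat) \<Rightarrow> (nat \<Rightarrow> real mat) \<Rightarrow> (nat \<Rightarrow> real mat) \<Rightarrow> bool" where
  "pgcs_eq p A B C D E F X Y \<longleftrightarrow>
     (\<forall>k\<in>{1..p}. A k * X k - Y k * B k = E k \<and> C k * X (cyc_suc p k) - Y k * D k = F k)"

text \<open>The matrix \<open>[X\<^sub>1, Y\<^sub>1, \<dots>, X\<^sub>p, Y\<^sub>p]\<close> with \<open>m\<close> rows.\<close>

definition interleave_cols ::
  "nat \<Rightarrow> nat \<Rightarrow> (nat \<Rightarrow> 'a::zero mat) \<Rightarrow> (nat \<Rightarrow> 'a mat) \<Rightarrow> 'a mat" where
  "interleave_cols p m X Y = hcat m (concat (map (\<lambda>k. [X k, Y k]) [1..<p + 1]))"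

text \<open>The coefficient matrix \<open>W\<close>: the inner lists run over the block columns of
  \<open>X\<^sub>1, Y\<^sub>1, \<dots>, X\<^sub>p, Y\<^sub>p\<close>.\<close>

definition pgcs_mat ::
  "nat \<Rightarrow> nat \<Rightarrow> nat \<Rightarrow> (nat \<Rightarrow> 'a::comm_ring_1 mat) \<Rightarrow> (nat \<Rightarrow> 'a mat) \<Rightarrow> (nat \<Rightarrow> 'a mat) \<Rightarrow>
   (nat \<Rightarrow> 'a mat) \<Rightarrow> 'a mat" where
  "pgcs_mat p m n A B C D =
     (let Z = 0\<^sub>m (m * n) (m * n) in
      vcat (2 * p * m * n) (concat (map (\<lambda>k.
        [hcat (m * n) (concat (map (\<lambda>l.
           [if l = k then kron (1\<^sub>m n) (A k) else Z,
            if l = k then - kron (transpose_mat (B k)) (1\<^sub>m m) else Z]) [1..<p + 1])),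
         hcat (m * n) (concat (map (\<lambda>l.
           [if l = cyc_suc p k then kron (1\<^sub>m n) (C k) else Z,
            if l = k then - kron (transpose_mat (D k)) (1\<^sub>m m) else Z]) [1..<p + 1]))])
        [1..<p + 1])))"

definition pgcs_H_block ::
  "nat \<Rightarrow> nat \<Rightarrow> nat \<Rightarrow> (nat \<Rightarrow> 'a::comm_ring_1) \<Rightarrow> (nat \<Rightarrow> 'a) \<Rightarrow> (nat \<Rightarrow> 'a) \<Rightarrow> (nat \<Rightarrow> 'a) \<Rightarrow>
   (nat \<Rightarrow> 'a) \<Rightarrow> (nat \<Rightarrow> 'a) \<Rightarrow> (nat \<Rightarrow> 'a mat) \<Rightarrow> (nat \<Rightarrow> 'a mat) \<Rightarrow> nat \<Rightarrow> 'a mat" where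
  "pgcs_H_block p m n \<alpha> \<beta> \<gamma> \<zeta> \<tau> \<delta> X Y k =
     vcat (2 * (m * m + n * n + m * n))
      [hcat (m * n)
        [\<alpha> k \<cdot>\<^sub>m kron (transpose_mat (X k)) (1\<^sub>m m), (- \<beta> k) \<cdot>\<^sub>m kron (1\<^sub>m n) (Y k),
         (- \<gamma> k) \<cdot>\<^sub>m 1\<^sub>m (m * n),
         0\<^sub>m (m * n) (m * m), 0\<^sub>m (m * n) (n * n), 0\<^sub>m (m * n) (m * n)],
       hcat (m * n)
        [0\<^sub>m (m * n) (m * m), 0\<^sub>m (m * n) (n * n), 0\<^sub>m (m * n) (m * n),
         \<zeta> k \<cdot>\<^sub>m kron (transpose_mat (X (cyc_suc p k))) (1\<^sub>m m), (- \<tau> k) \<cdot>\<^sub>m kron (1\<^sub>m n) (Y k),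
         (- \<delta> k) \<cdot>\<^sub>m 1\<^sub>m (m * n)]]"

definition pgcs_H ::
  "nat \<Rightarrow> nat \<Rightarrow> nat \<Rightarrow> (nat \<Rightarrow> 'a::comm_ring_1) \<Rightarrow> (nat \<Rightarrow> 'a) \<Rightarrow> (nat \<Rightarrow> 'a) \<Rightarrow> (nat \<Rightarrow> 'a) \<Rightarrow>
   (nat \<Rightarrow> 'a) \<Rightarrow> (nat \<Rightarrow> 'a) \<Rightarrow> (nat \<Rightarrow> 'a mat) \<Rightarrow> (nat \<Rightarrow> 'a mat) \<Rightarrow> 'a mat" where
  "pgcs_H p m n \<alpha> \<beta> \<gamma> \<zeta> \<tau> \<delta> X Y =
     diag_block_mat (map (pgcs_H_block p m n \<alpha> \<beta> \<gamma> \<zeta> \<tau> \<delta> X Y) [1..<p + 1])"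

definition pgcs_u ::
  "nat \<Rightarrow> (nat \<Rightarrow> 'a::field) \<Rightarrow> (nat \<Rightarrow> 'a) \<Rightarrow> (nat \<Rightarrow> 'a) \<Rightarrow> (nat \<Rightarrow> 'a) \<Rightarrow> (nat \<Rightarrow> 'a) \<Rightarrow> (nat \<Rightarrow> 'a) \<Rightarrow>
   (nat \<Rightarrow> 'a mat) \<Rightarrow> (nat \<Rightarrow> 'a mat) \<Rightarrow> (nat \<Rightarrow> 'a mat) \<Rightarrow> (nat \<Rightarrow> 'a mat) \<Rightarrow> (nat \<Rightarrow> 'a mat) \<Rightarrow>
   (nat \<Rightarrow> 'a mat) \<Rightarrow> 'a vec" where
  "pgcs_u p \<alpha> \<beta> \<gamma> \<zeta> \<tau> \<delta> \<Delta>A \<Delta>B \<Delta>C \<Delta>D \<Delta>E \<Delta>F =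
     vec_concat (concat (map (\<lambda>k.
       [(1 / \<alpha> k) \<cdot>\<^sub>v vectorize (\<Delta>A k), (1 / \<beta> k) \<cdot>\<^sub>v vectorize (\<Delta>B k),
        (1 / \<gamma> k) \<cdot>\<^sub>v vectorize (\<Delta>E k), (1 / \<zeta> k) \<cdot>\<^sub>v vectorize (\<Delta>C k),
        (1 / \<tau> k) \<cdot>\<^sub>v vectorize (\<Delta>D k), (1 / \<delta> k) \<cdot>\<^sub>v vectorize (\<Delta>F k)]) [1..<p + 1]))"

text \<open>The solutions \<open>(\<Delta>X, \<Delta>Y)\<close> of the perturbed equation; the families are extensional, so that
  uniqueness is meant for the indices \<open>1, \<dots>, p\<close> only.\<close>

definition perturbed_solutions ::
  "nat \<Rightarrow> nat \<Rightarrow> nat \<Rightarrow>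
   (nat \<Rightarrow> real mat) \<Rightarrow> (nat \<Rightarrow> real mat) \<Rightarrow> (nat \<Rightarrow> real mat) \<Rightarrow> (nat \<Rightarrow> real mat) \<Rightarrow>
   (nat \<Rightarrow> real mat) \<Rightarrow> (nat \<Rightarrow> real mat) \<Rightarrow>
   (nat \<Rightarrow> real mat) \<Rightarrow> (nat \<Rightarrow> real mat) \<Rightarrow> (nat \<Rightarrow> real mat) \<Rightarrow> (nat \<Rightarrow> real mat) \<Rightarrow>
   (nat \<Rightarrow> real mat) \<Rightarrow> (nat \<Rightarrow> real mat) \<Rightarrow>
   (nat \<Rightarrow> real mat) \<Rightarrow> (nat \<Rightarrow> real mat) \<Rightarrow>
   ((nat \<Rightarrow> real mat) \<times> (nat \<Rightarrow> real mat)) set" where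
  "perturbed_solutions p m n A B C D E F \<Delta>A \<Delta>B \<Delta>C \<Delta>D \<Delta>E \<Delta>F X Y =
     {(\<Delta>X, \<Delta>Y).
        \<Delta>X \<in> {1..p} \<rightarrow>\<^sub>E carrier_mat m n \<and> \<Delta>Y \<in> {1..p} \<rightarrow>\<^sub>E carrier_mat m n \<and>
        pgcs_eq p (\<lambda>k. A k + \<Delta>A k) (\<lambda>k. B k + \<Delta>B k) (\<lambda>k. C k + \<Delta>C k) (\<lambda>k. D k + \<Delta>D k)
          (\<lambda>k. E k + \<Delta>E k) (\<lambda>k. F k + \<Delta>F k) (\<lambda>k. X k + \<Delta>X k) (\<lambda>k. Y k + \<Delta>Y k)}"

end

theory Submission
  imports Defs "Jordan_Normal_Form.Determinant"
begin

text \<open>Stacking columns turns the perturbed equation into \<open>(W + \<Delta>W) z = - H\<^sub>1 u\<close>, where \<open>z\<close> stacks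
  the unknowns \<open>\<Delta>X\<^sub>k, \<Delta>Y\<^sub>k\<close>: in each block the products of unperturbed data cancel, and the
  terms \<open>\<Delta>A\<^sub>k X\<^sub>k - Y\<^sub>k \<Delta>B\<^sub>k - \<Delta>E\<^sub>k\<close> and \<open>\<Delta>C\<^sub>k X\<^sub>k\<^sub>+\<^sub>1 - Y\<^sub>k \<Delta>D\<^sub>k - \<Delta>F\<^sub>k\<close> that do not involve
  \<open>z\<close> are the blocks of \<open>H\<^sub>1 u\<close>. Multiplying by \<open>W\<^sup>-\<^sup>1\<close> gives \<open>z = - W\<^sup>-\<^sup>1 H\<^sub>1 u - W\<^sup>-\<^sup>1 \<Delta>W z\<close>, so
  \<open>(1 - \<parallel>W\<^sup>-\<^sup>1 \<Delta>W\<parallel>) \<parallel>z\<parallel> \<le> \<parallel>W\<^sup>-\<^sup>1 H\<^sub>1 u\<parallel>\<close>. The same estimate with right-hand side \<open>0\<close> shows that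
  \<open>W + \<Delta>W\<close> has trivial kernel, which yields existence and uniqueness.\<close>

section \<open>Euclidean and spectral norm\<close>

lemma vec_norm2_nonneg [simp]: "0 \<le> vec_norm2 v"
  by (simp add: vec_norm2_def)

lemma vec_norm2_zero [simp]: "vec_norm2 (0\<^sub>v n) = 0"
  by (simp add: vec_norm2_def L2_set_def)

lemma vec_norm2_eq_0D: "vec_norm2 v = 0 \<Longrightarrow> v = 0\<^sub>v (dim_vec v)"
  by (intro eq_vecI) (auto simp: vec_norm2_def L2_set_eq_0_iff)

lemma vec_norm2_uminus [simp]: "vec_norm2 (- v) = vec_norm2 v"
  by (simp add: vec_norm2_def L2_set_def)

lemma vec_norm2_power2: "(vec_norm2 v)\<^sup>2 = v \<bullet> v"
  by (simp add: vec_norm2_def L2_set_def sum_nonneg scalar_prod_def atLeast0LessThan power2_eq_square)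

lemma vec_norm2_smult: "vec_norm2 (c \<cdot>\<^sub>v v) = \<bar>c\<bar> * vec_norm2 v"
proof -
  have "vec_norm2 (c \<cdot>\<^sub>v v) = L2_set (\<lambda>i. \<bar>c\<bar> * v $ i) {..<dim_vec v}"
    by (simp add: vec_norm2_def L2_set_def power_mult_distrib)
  then show ?thesis
    by (simp add: vec_norm2_def L2_set_right_distrib)
qed

lemma vec_norm2_add_le:
  assumes "v \<in> carrier_vec n" "w \<in> carrier_vec n"
  shows "vec_norm2 (v + w) \<le> vec_norm2 v + vec_norm2 w"
proof -
  have "vec_norm2 (v + w) = L2_set (\<lambda>i. v $ i + w $ i) {..<n}"
    using assms by (auto simp: vec_norm2_def intro: L2_set_cong)
  then show ?thesis
    using assms L2_set_triangle_ineq[of "($) v" "($) w" "{..<n}"] by (simp add: vec_norm2_def)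
qed

lemma vec_norm2_append_power2:
  "(vec_norm2 (v @\<^sub>v w))\<^sup>2 = (vec_norm2 v)\<^sup>2 + (vec_norm2 w)\<^sup>2"
  unfolding vec_norm2_power2 by (rule scalar_prod_append) (rule carrier_vec_dim_vec)+

lemma scalar_prod_le_vec_norm2:
  fixes v w :: "real vec"
  assumes "dim_vec v = dim_vec w"
  shows "\<bar>v \<bullet> w\<bar> \<le> vec_norm2 v * vec_norm2 w"
proof -
  have "\<bar>v \<bullet> w\<bar> \<le> (\<Sum>i<dim_vec w. \<bar>v $ i\<bar> * \<bar>w $ i\<bar>)"
    unfolding scalar_prod_def atLeast0LessThan
    by (rule order_trans[OF sum_abs]) (simp add: abs_mult)
  also have "\<dots> \<le> vec_norm2 v * vec_norm2 w"
    unfolding vec_norm2_def assms by (rule L2_set_mult_ineq)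
  finally show ?thesis .
qed

section \<open>Boundedness and submultiplicativity of the spectral norm\<close>

text \<open>Cauchy-Schwarz is applied to each row; the constant is the Frobenius norm of
  \<open>A\<close>, written row by row. Its only purpose is to bound the quotients in
  \<open>spec_norm\<close>.\<close>

lemma mult_mat_vec_norm2_bound:
  fixes A :: "real mat"
  assumes "x \<in> carrier_vec (dim_col A)"
  shows "vec_norm2 (A *\<^sub>v x) \<le> L2_set (\<lambda>i. vec_norm2 (row A i)) {..<dim_row A} * vec_norm2 x"
proof -
  have "vec_norm2 (A *\<^sub>v x) = L2_set (\<lambda>i. \<bar>row A i \<bullet> x\<bar>) {..<dim_row A}"
    by (auto simp: vec_norm2_def L2_set_def)
  also have "\<dots> \<le> L2_set (\<lambda>i. vec_norm2 (row A i) * vec_norm2 x) {..<dim_row A}"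
    using assms by (intro L2_set_mono scalar_prod_le_vec_norm2) auto
  finally show ?thesis
    by (simp add: L2_set_left_distrib)
qed

text \<open>A supremum of reals carries information only if the set is bounded above; both facts
  about \<open>spec_norm\<close> derived below rest on this.\<close>

lemma bdd_above_spec_norm:
  fixes A :: "real mat"
  shows "bdd_above ((\<lambda>x. vec_norm2 (A *\<^sub>v x) / vec_norm2 x) ` carrier_vec (dim_col A))"
proof (rule bdd_aboveI2)
  fix x :: "real vec" assume x: "x \<in> carrier_vec (dim_col A)"
  show "vec_norm2 (A *\<^sub>v x) / vec_norm2 x \<le> L2_set (\<lambda>i. vec_norm2 (row A i)) {..<dim_row A}"
  proof (cases "vec_norm2 x = 0")
    case False
    then have "0 < vec_norm2 x"
      by (simp add: order_less_le)
    then show ?thesis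
      using mult_mat_vec_norm2_bound[OF x] by (simp add: pos_divide_le_eq)
  qed simp
qed

text \<open>The zero vector is in the index set and contributes 0 / 0 = 0, so the supremum is at
  least 0, even if \<open>A\<close> has no columns.\<close>

lemma spec_norm_nonneg: "0 \<le> spec_norm A"
  unfolding spec_norm_def
  by (rule cSUP_upper2[OF bdd_above_spec_norm, of "0\<^sub>v (dim_col A)"]) auto

lemma vec_norm2_mult_mat_vec_le:
  assumes "A \<in> carrier_mat nr nc" "x \<in> carrier_vec nc"
  shows "vec_norm2 (A *\<^sub>v x) \<le> spec_norm A * vec_norm2 x"
\<comment> \<open>For a vector of norm 0 the quotient has the default value 0 and says nothing about
  \<open>A *\<^sub>v x\<close>; this case needs \<open>x\<close> to be the zero vector.\<close>
proof (cases "vec_norm2 x = 0")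
  case True
  then have "x = 0\<^sub>v nc"
    using vec_norm2_eq_0D[of x] assms(2) by auto
  then have "A *\<^sub>v x = 0\<^sub>v nr"
    using assms by (intro eq_vecI) auto
  with True show ?thesis by simp
next
  case False
  then have "0 < vec_norm2 x"
    by (simp add: order_less_le)
  moreover have "vec_norm2 (A *\<^sub>v x) / vec_norm2 x \<le> spec_norm A"
    unfolding spec_norm_def
    using assms by (intro cSUP_upper bdd_above_spec_norm) auto
  ultimately show ?thesis
    by (simp add: pos_divide_le_eq)
qed

section \<open>Perturbation of a nonsingular linear system\<close>

text \<open>Gauss-Jordan elimination returns \<open>None\<close> only for matrices that are not
  units of the matrix ring, and invertibility makes \<open>A\<close> a unit, so \<open>the\<close>
  is applied to a proper value.\<close>

lemma the_mat_inverse: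
  fixes A :: "'a::field mat"
  assumes A: "A \<in> carrier_mat n n" and inv: "invertible_mat A"
  shows "the (mat_inverse A) \<in> carrier_mat n n"
    and "A * the (mat_inverse A) = 1\<^sub>m n" and "the (mat_inverse A) * A = 1\<^sub>m n"
proof -
  from inv obtain B where B: "A * B = 1\<^sub>m n" "B * A = 1\<^sub>m (dim_row B)"
    using A by (auto simp: invertible_mat_def inverts_mat_def)
  \<comment> \<open>\<open>invertible_mat\<close> does not state the dimensions of the inverse; they
    are read off from the column counts in the two product identities.\<close>
  have "dim_col B = n"
    using arg_cong[OF B(1), of dim_col] by simp
  moreover have "dim_row B = n"
    using arg_cong[OF B(2), of dim_col] A by simp
  ultimately have "A \<in> Units (ring_mat TYPE('a) n ())"
    using A B unfolding Units_def by (auto simp: ring_mat_def)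
  then obtain C where "mat_inverse A = Some C"
    using mat_inverse(1)[OF A, of "()"] by (cases "mat_inverse A") auto
  with mat_inverse(2)[OF A this]
  show "the (mat_inverse A) \<in> carrier_mat n n"
    and "A * the (mat_inverse A) = 1\<^sub>m n" and "the (mat_inverse A) * A = 1\<^sub>m n"
    by simp_all
qed

text \<open>After multiplication by \<open>Winv\<close>, the term in \<open>Winv * V\<close> is
  absorbed into the left side, where \<open>small\<close> keeps the factor positive. The right-hand
  side \<open>h\<close> is arbitrary because the bound is used twice: with \<open>h\<close> zero for
  the kernel of \<open>W + V\<close>, and with \<open>H1 *\<^sub>v u\<close> for the error
  estimate.\<close>

lemma perturbed_system_norm_bound:
  fixes W Winv V :: "real mat"
  assumes W: "W \<in> carrier_mat n n" and Winv: "Winv \<in> carrier_mat n n" and V: "V \<in> carrier_mat n n"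
    and inv: "Winv * W = 1\<^sub>m n" and small: "spec_norm (Winv * V) < 1"
    and z: "z \<in> carrier_vec n" and h: "h \<in> carrier_vec n"
    and eq: "(W + V) *\<^sub>v z = - h"
  shows "vec_norm2 z \<le> vec_norm2 (Winv *\<^sub>v h) / (1 - spec_norm (Winv * V))"
proof -
  have "Winv *\<^sub>v ((W + V) *\<^sub>v z) = (Winv * W) *\<^sub>v z + (Winv * V) *\<^sub>v z"
    using W Winv V z by (simp add: add_mult_distrib_mat_vec[of W n n V] mult_add_distrib_mat_vec[of Winv n n])
  moreover have "Winv *\<^sub>v (- h) = - (Winv *\<^sub>v h)"
    using Winv h by (intro eq_vecI) auto
  ultimately have "z + (Winv * V) *\<^sub>v z = - (Winv *\<^sub>v h)"
    using z eq inv by simp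
  \<comment> \<open>Adding and subtracting the perturbation term writes \<open>z\<close> as a sum of
    two vectors whose norms are under control, ready for the triangle inequality.\<close>
  moreover have "z = (z + (Winv * V) *\<^sub>v z) + - ((Winv * V) *\<^sub>v z)"
    using z Winv V by (intro eq_vecI) auto
  ultimately have "vec_norm2 z = vec_norm2 (- (Winv *\<^sub>v h) + - ((Winv * V) *\<^sub>v z))"
    by simp
  also have "\<dots> \<le> vec_norm2 (Winv *\<^sub>v h) + vec_norm2 ((Winv * V) *\<^sub>v z)"
    using vec_norm2_add_le[of "- (Winv *\<^sub>v h)" n "- ((Winv * V) *\<^sub>v z)"] Winv V h z by simp
  also have "\<dots> \<le> vec_norm2 (Winv *\<^sub>v h) + spec_norm (Winv * V) * vec_norm2 z"
    using Winv V z by (intro add_left_mono vec_norm2_mult_mat_vec_le) auto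
  finally have "vec_norm2 z \<le> \<dots>" .
  then show ?thesis
    using small by (simp add: pos_le_divide_eq algebra_simps)
qed

text \<open>A kernel vector of \<open>W + V\<close> solves the system with right-hand side zero, so
  the preceding bound forces its norm to be 0. Hence the determinant is nonzero and a two-sided
  inverse exists; no Neumann series is involved.\<close>

lemma perturbed_system_ex1:
  fixes W Winv V :: "real mat"
  assumes W: "W \<in> carrier_mat n n" and Winv: "Winv \<in> carrier_mat n n" and V: "V \<in> carrier_mat n n"
    and inv: "Winv * W = 1\<^sub>m n" and small: "spec_norm (Winv * V) < 1"
    and g: "g \<in> carrier_vec n"
  shows "\<exists>!z. z \<in> carrier_vec n \<and> (W + V) *\<^sub>v z = g"
proof -
  have "det (W + V) \<noteq> 0"
  proof
    assume "det (W + V) = 0"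
    then obtain v where v: "v \<in> carrier_vec n" "v \<noteq> 0\<^sub>v n" "(W + V) *\<^sub>v v = 0\<^sub>v n"
      using det_0_iff_vec_prod_zero[of "W + V" n] W V by auto
    have "vec_norm2 v \<le> vec_norm2 (Winv *\<^sub>v 0\<^sub>v n) / (1 - spec_norm (Winv * V))"
      using v by (intro perturbed_system_norm_bound[OF W Winv V inv small]) auto
    moreover have "Winv *\<^sub>v 0\<^sub>v n = 0\<^sub>v n"
      using Winv by (intro eq_vecI) auto
    ultimately have "vec_norm2 v = 0"
      by (simp add: order_antisym)
    then show False
      using v vec_norm2_eq_0D[of v] by auto
  qed
  then have "W + V \<in> Units (ring_mat TYPE(real) n ())"
    using W V by (intro det_non_zero_imp_unit) auto
  then obtain B where B: "B \<in> carrier_mat n n" "B * (W + V) = 1\<^sub>m n" "(W + V) * B = 1\<^sub>m n"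
    by (auto simp: Units_def ring_mat_def)
  show ?thesis
  proof (rule ex1I[of _ "B *\<^sub>v g"])
    show "B *\<^sub>v g \<in> carrier_vec n \<and> (W + V) *\<^sub>v (B *\<^sub>v g) = g"
      using B g W V by (simp flip: assoc_mult_mat_vec[of "W + V" n n])
    fix z assume z: "z \<in> carrier_vec n \<and> (W + V) *\<^sub>v z = g"
    then have "B *\<^sub>v g = (B * (W + V)) *\<^sub>v z"
      using B W V by (subst assoc_mult_mat_vec[of _ n n _ n]) auto
    then show "z = B *\<^sub>v g"
      using B z by simp
  qed
qed

section \<open>Vectorization, Kronecker products and block matrices\<close>

text \<open>Column-major numbering is a bijection between positions and index pairs, with inverse
  sending \<open>(i, j)\<close> to \<open>i + j * r\<close>. It converts sums over the coordinates
  of a vectorized matrix into double sums over its entries.\<close>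

lemma sum_mod_div:
  fixes f :: "nat \<Rightarrow> nat \<Rightarrow> 'a::comm_monoid_add"
  shows "(\<Sum>k<r * c. f (k mod r) (k div r)) = (\<Sum>(i, j)\<in>{..<r} \<times> {..<c}. f i j)"
\<comment> \<open>For \<open>r = 0\<close> both index sets are empty; otherwise
  \<open>k mod r\<close> really is below \<open>r\<close>.\<close>
proof (cases "r = 0")
  case False
  have "i + j * r < r * c" if "i < r" "j < c" for i j
  proof -
    have "i + j * r < r * Suc j" using that by simp
    also have "\<dots> \<le> r * c" using that by (intro mult_le_mono2) auto
    finally show ?thesis .
  qed
  then show ?thesis
    using False
    by (intro sum.reindex_bij_witness[of _ "\<lambda>(i, j). i + j * r" "\<lambda>k. (k mod r, k div r)"])
       (auto simp: less_mult_imp_div_less mult.commute)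
qed simp

lemma dim_vectorize [simp]: "dim_vec (vectorize A) = dim_row A * dim_col A"
  by (simp add: vectorize_def)

lemma vectorize_carrier [simp, intro]: "A \<in> carrier_mat r c \<Longrightarrow> vectorize A \<in> carrier_vec (r * c)"
  by (auto simp: carrier_dim_vec)

lemma index_vectorize:
  "i < dim_row A * dim_col A \<Longrightarrow> vectorize A $ i = A $$ (i mod dim_row A, i div dim_row A)"
  by (simp add: vectorize_def)

lemma mod_div_less:
  fixes i r c :: nat
  assumes "i < r * c"
  shows "i mod r < r" and "i div r < c"
proof -
  show "i mod r < r" using assms by (cases "r = 0") auto
  show "i div r < c" using assms by (simp add: less_mult_imp_div_less mult.commute)
qed

text \<open>Renumbering the entries does not change their sum of squares. This transfers the
  Euclidean estimate for the stacked unknowns to the Frobenius norm in the theorem.\<close>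

lemma vec_norm2_vectorize: "vec_norm2 (vectorize A) = frob_norm A"
proof -
  have "(\<Sum>k<dim_row A * dim_col A. (vectorize A $ k)\<^sup>2)
      = (\<Sum>k<dim_row A * dim_col A. (A $$ (k mod dim_row A, k div dim_row A))\<^sup>2)"
    by (simp add: index_vectorize)
  then show ?thesis
    by (simp add: vec_norm2_def frob_norm_def L2_set_def case_prod_unfold
        sum_mod_div[where f = "\<lambda>i j. (A $$ (i, j))\<^sup>2"])
qed

lemma vectorize_add:
  "A \<in> carrier_mat r c \<Longrightarrow> B \<in> carrier_mat r c \<Longrightarrow> vectorize (A + B) = vectorize A + vectorize B"
  by (intro eq_vecI) (auto simp: index_vectorize mod_div_less)

lemma vectorize_minus:
  "A \<in> carrier_mat r c \<Longrightarrow> B \<in> carrier_mat r c \<Longrightarrow> vectorize (A - B) = vectorize A - vectorize B"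
  by (intro eq_vecI) (auto simp: index_vectorize mod_div_less)

lemma vectorize_inject:
  assumes "A \<in> carrier_mat r c" "B \<in> carrier_mat r c" and eq: "vectorize A = vectorize B"
  shows "A = B"
proof (rule eq_matI)
  fix i j assume "i < dim_row B" "j < dim_col B"
  then have ij: "i < r" "j < c" using assms by auto
  \<comment> \<open>Entry \<open>(i, j)\<close> is recovered from position \<open>i + j * r\<close>,
    which must be shown to lie within the vector.\<close>
  have "i + j * r < r * Suc j" using ij by simp
  also have "\<dots> \<le> r * c" using ij by (intro mult_le_mono2) auto
  finally have "i + j * r < r * c" .
  then show "A $$ (i, j) = B $$ (i, j)"
    using index_vectorize[of "i + j * r" A] index_vectorize[of "i + j * r" B] assms ij by simp
qed (use assms in auto)

lemma vectorize_surj: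
  assumes "v \<in> carrier_vec (r * c)"
  obtains A where "A \<in> carrier_mat r c" and "v = vectorize A"
proof
  show "mat r c (\<lambda>(i, j). v $ (i + j * r)) \<in> carrier_mat r c" by simp
  show "v = vectorize (mat r c (\<lambda>(i, j). v $ (i + j * r)))"
    using assms by (intro eq_vecI) (auto simp: index_vectorize mod_div_less)
qed

section \<open>Kronecker products acting on vectorized matrices\<close>

lemma kron_carrier [simp, intro]:
  "A \<in> carrier_mat r c \<Longrightarrow> B \<in> carrier_mat r' c' \<Longrightarrow> kron A B \<in> carrier_mat (r * r') (c * c')"
  by (auto simp: kron_def)

text \<open>Splitting the summation index by \<open>sum_mod_div\<close> turns coordinate
  \<open>i\<close> of the left side into the double sum that computes entry
  \<open>(i mod a, i div a)\<close> of the triple product. The two specializations that follow, with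
  an identity as one factor, cover every Kronecker block of \<open>W\<close> and
  \<open>H1\<close>.\<close>

lemma kron_mult_vectorize:
  fixes A :: "'a::comm_ring_1 mat"
  assumes A: "A \<in> carrier_mat a m" and X: "X \<in> carrier_mat m n" and B: "B \<in> carrier_mat n b"
  shows "kron (transpose_mat B) A *\<^sub>v vectorize X = vectorize (A * X * B)"
proof (rule eq_vecI)
  fix i assume "i < dim_vec (vectorize (A * X * B))"
  then have i: "i < b * a" and ia: "i mod a < a" "i div a < b"
    using A B mod_div_less[of i a b] by (auto simp: mult.commute)
  have "(kron (transpose_mat B) A *\<^sub>v vectorize X) $ i
      = (\<Sum>k<n * m. kron (transpose_mat B) A $$ (i, k) * vectorize X $ k)"
    using A B X i by (simp add: scalar_prod_def kron_def atLeast0LessThan mult.commute)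
  also have "\<dots> = (\<Sum>k<m * n. B $$ (k div m, i div a) * A $$ (i mod a, k mod m) * X $$ (k mod m, k div m))"
    using A B X i ia
    by (intro sum.cong) (auto simp: kron_def index_vectorize mod_div_less mult.commute)
  also have "\<dots> = (\<Sum>k<m. \<Sum>l<n. B $$ (l, i div a) * A $$ (i mod a, k) * X $$ (k, l))"
    by (simp add: sum_mod_div[where f = "\<lambda>k l. B $$ (l, i div a) * A $$ (i mod a, k) * X $$ (k, l)"]
        sum.cartesian_product)
  also have "\<dots> = (\<Sum>k<m. A $$ (i mod a, k) * (\<Sum>l<n. X $$ (k, l) * B $$ (l, i div a)))"
    by (simp add: sum_distrib_left ac_simps)
  also have "\<dots> = vectorize (A * X * B) $ i"
    using A B X i ia by (simp add: index_vectorize scalar_prod_def atLeast0LessThan mult.commute[of b a])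
  finally show "(kron (transpose_mat B) A *\<^sub>v vectorize X) $ i = vectorize (A * X * B) $ i" .
qed (use assms in \<open>simp add: kron_def mult.commute\<close>)

lemma kron_one_left_mult_vectorize:
  fixes A :: "'a::comm_ring_1 mat"
  assumes "A \<in> carrier_mat a m" and "X \<in> carrier_mat m n"
  shows "kron (1\<^sub>m n) A *\<^sub>v vectorize X = vectorize (A * X)"
  using kron_mult_vectorize[OF assms one_carrier_mat] assms by (simp add: transpose_one)

lemma kron_one_right_mult_vectorize:
  fixes X :: "'a::comm_ring_1 mat"
  assumes "X \<in> carrier_mat m n" and "B \<in> carrier_mat n b"
  shows "kron (transpose_mat B) (1\<^sub>m m) *\<^sub>v vectorize X = vectorize (X * B)"
  using kron_mult_vectorize[OF one_carrier_mat assms] assms by simp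

section \<open>Concatenation of matrices and vectors by blocks\<close>

lemma append_cols_carrier [simp, intro]:
  "A \<in> carrier_mat r c \<Longrightarrow> B \<in> carrier_mat r d \<Longrightarrow> append_cols A B \<in> carrier_mat r (c + d)"
  by (auto simp: append_cols_def)

text \<open>This is block multiplication for a four-block matrix whose two lower blocks have no
  rows.\<close>

lemma append_cols_mult_vec:
  fixes A :: "'a::comm_ring_1 mat"
  assumes "A \<in> carrier_mat r c" "B \<in> carrier_mat r d" "x \<in> carrier_vec c" "y \<in> carrier_vec d"
  shows "append_cols A B *\<^sub>v (x @\<^sub>v y) = A *\<^sub>v x + B *\<^sub>v y"
  using assms unfolding append_cols_def
  by (subst four_block_mat_mult_vec[of _ r c _ d _ 0]) (auto intro!: eq_vecI)

text \<open>In column-major order the left matrix occupies the first \<open>r * c\<close> positions.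
  Past them, subtracting \<open>r * c\<close> keeps the row index and lowers the column index by
  \<open>c\<close>.\<close>

lemma vectorize_append_cols:
  assumes A: "A \<in> carrier_mat r c" and B: "B \<in> carrier_mat r d"
  shows "vectorize (append_cols A B) = vectorize A @\<^sub>v vectorize B"
proof (rule eq_vecI)
  fix i assume "i < dim_vec (vectorize A @\<^sub>v vectorize B)"
  then have i: "i < r * (c + d)" using A B by (simp add: algebra_simps)
  then have r: "0 < r" by (cases r) auto
  have dims: "dim_row (append_cols A B) = r" "dim_col (append_cols A B) = c + d"
    using append_cols_carrier[OF A B] by auto
  have "i div r < c \<longleftrightarrow> i < r * c"
    using r by (simp add: div_less_iff_less_mult mult.commute)
  moreover have "(i - r * c) mod r = i mod r" "(i - r * c) div r = i div r - c" if "r * c \<le> i"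
  proof -
    define j where "j = i - r * c"
    have "i = j + c * r" using that by (simp add: j_def mult.commute)
    then have "j mod r = i mod r" "j div r = i div r - c" using r by simp_all
    then show "(i - r * c) mod r = i mod r" "(i - r * c) div r = i div r - c"
      by (simp_all only: j_def)
  qed
  ultimately show "vectorize (append_cols A B) $ i = (vectorize A @\<^sub>v vectorize B) $ i"
    using A B i r mod_div_less[OF i] dims
    by (auto simp: index_vectorize append_cols_def algebra_simps)
qed (use assms in \<open>auto simp: append_cols_def algebra_simps\<close>)

lemma hcat_carrier:
  "(\<And>A. A \<in> set As \<Longrightarrow> dim_row A = r) \<Longrightarrow> hcat r As \<in> carrier_mat r (sum_list (map dim_col As))"
  by (induction As) (auto simp: hcat_def)

lemma vcat_carrier:
  "(\<And>A. A \<in> set As \<Longrightarrow> dim_col A = c) \<Longrightarrow> vcat c As \<in> carrier_mat (sum_list (map dim_row As)) c"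
  by (induction As) (auto simp: vcat_def)

lemma dim_vec_concat [simp]: "dim_vec (vec_concat vs) = sum_list (map dim_vec vs)"
  by (induction vs) (auto simp: vec_concat_def)

lemma append_vec_vNil_right [simp]: "v @\<^sub>v vNil = v"
  by (intro eq_vecI) auto

lemma append_vec_assoc: "(u @\<^sub>v v) @\<^sub>v w = u @\<^sub>v v @\<^sub>v w"
  by (intro eq_vecI) auto

lemma vec_concat_Nil [simp]: "vec_concat [] = vNil"
  and vec_concat_Cons [simp]: "vec_concat (v # vs) = v @\<^sub>v vec_concat vs"
  by (simp_all add: vec_concat_def)

lemma vec_concat_append: "vec_concat (vs @ ws) = vec_concat vs @\<^sub>v vec_concat ws"
  by (induction vs) (auto simp: append_vec_assoc)

lemma vec_concat_concat: "vec_concat (concat vss) = vec_concat (map vec_concat vss)"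
  by (induction vss) (auto simp: vec_concat_append)

lemma vec_norm2_vec_concat_power2:
  "(vec_norm2 (vec_concat vs))\<^sup>2 = (\<Sum>v\<leftarrow>vs. (vec_norm2 v)\<^sup>2)"
proof (induction vs)
  case Nil
  then show ?case by (simp add: vec_norm2_def)
qed (simp add: vec_norm2_append_power2)

lemma vec_concat_map_carrier:
  "(\<And>k. k \<in> set ks \<Longrightarrow> f k \<in> carrier_vec N) \<Longrightarrow> vec_concat (map f ks) \<in> carrier_vec (length ks * N)"
  by (induction ks) (auto intro: append_carrier_vec)

text \<open>Corresponding pieces have equal dimensions, so both concatenations are cut at the same
  places and can be compared piece by piece.\<close>

lemma vec_concat_map_inject:
  assumes "vec_concat (map f ks) = vec_concat (map g ks)"
    and "\<And>k. k \<in> set ks \<Longrightarrow> dim_vec (f k) = dim_vec (g k)"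
    and "k \<in> set ks"
  shows "f k = g k"
  using assms
proof (induction ks)
  case (Cons l ks)
  have "f l = g l \<and> vec_concat (map f ks) = vec_concat (map g ks)"
    using Cons.prems(1) append_vec_eq[OF carrier_vec_dim_vec carrier_vecI, of "g l" "f l"]
      Cons.prems(2)[of l] by simp
  then show ?case
    using Cons by auto
qed simp

text \<open>The pieces are cut off from the front one at a time. They are recorded as a function of
  the key, so distinctness of \<open>ks\<close> ensures that setting the piece for a new key leaves
  the other pieces intact.\<close>

lemma vec_concat_map_surj:
  assumes "distinct ks" and "v \<in> carrier_vec (length ks * N)"
  obtains f where "\<And>k. k \<in> set ks \<Longrightarrow> f k \<in> carrier_vec N" and "v = vec_concat (map f ks)"
  using assms
proof (induction ks arbitrary: v thesis)
  case Nil
  from Nil(3) have "v = vNil"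
    by (intro eq_vecI) auto
  then show ?case
    using Nil(1)[of undefined] by simp
next
  case (Cons l ks)
  from Cons.prems(2) obtain f where f: "\<And>k. k \<in> set ks \<Longrightarrow> f k \<in> carrier_vec N"
      "vec_last v (length ks * N) = vec_concat (map f ks)"
    using Cons.IH[of "vec_last v (length ks * N)"] by auto
  define g where "g = f(l := vec_first v N)"
  have "vec_first v N @\<^sub>v vec_last v (length ks * N) = v"
    using Cons.prems(3) by (intro vec_first_last_append) simp
  moreover have "map g ks = map f ks"
    using Cons.prems(2) by (intro map_cong) (auto simp: g_def)
  moreover have "g l = vec_first v N"
    by (simp add: g_def)
  ultimately have "v = vec_concat (map g (l # ks))"
    using f(2) by (simp only: list.map vec_concat_Cons)
  moreover have "g k \<in> carrier_vec N" if "k \<in> set (l # ks)" for k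
    using f(1) that by (auto simp: g_def)
  ultimately show ?case
    by (intro Cons.prems(1)[of g])
qed

lemma vec_concat_map_add:
  fixes f g :: "'b \<Rightarrow> 'a::monoid_add vec"
  assumes "\<And>k. k \<in> set ks \<Longrightarrow> dim_vec (f k) = dim_vec (g k)"
  shows "vec_concat (map f ks) + vec_concat (map g ks) = vec_concat (map (\<lambda>k. f k + g k) ks)"
  using assms
proof (induction ks)
  case (Cons l ks)
  have "map (dim_vec \<circ> f) ks = map (dim_vec \<circ> g) ks"
    using Cons.prems by auto
  then have "dim_vec (vec_concat (map f ks)) = dim_vec (vec_concat (map g ks))"
    by (simp only: dim_vec_concat map_map)
  moreover have "dim_vec (f l) = dim_vec (g l)"
    using Cons.prems by simp
  ultimately have "(f l @\<^sub>v vec_concat (map f ks)) + (g l @\<^sub>v vec_concat (map g ks))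
      = (f l + g l) @\<^sub>v (vec_concat (map f ks) + vec_concat (map g ks))"
    by (intro append_vec_add) (auto intro!: carrier_vecI)
  then show ?case
    using Cons by simp
qed auto

lemma hcat_mult_vec_concat:
  fixes A :: "'a::comm_ring_1 mat"
  assumes "A \<in> carrier_mat r (dim_vec v)" and "\<And>B. B \<in> set As \<Longrightarrow> dim_row B = r"
    and "map dim_col As = map dim_vec vs"
  shows "hcat r (A # As) *\<^sub>v vec_concat (v # vs) = A *\<^sub>v v + hcat r As *\<^sub>v vec_concat vs"
proof -
  have "hcat r As \<in> carrier_mat r (dim_vec (vec_concat vs))"
    using hcat_carrier[of As r] assms by simp
  then have "append_cols A (hcat r As) *\<^sub>v (v @\<^sub>v vec_concat vs) = A *\<^sub>v v + hcat r As *\<^sub>v vec_concat vs"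
    using assms(1) by (intro append_cols_mult_vec) (auto intro!: carrier_vecI)
  then show ?thesis
    by (simp add: hcat_def)
qed

lemma vcat_mult_vec:
  fixes v :: "'a::comm_ring_1 vec"
  assumes "\<And>A. A \<in> set As \<Longrightarrow> dim_col A = c" and "v \<in> carrier_vec c"
  shows "vcat c As *\<^sub>v v = vec_concat (map (\<lambda>A. A *\<^sub>v v) As)"
  using assms
proof (induction As)
  case (Cons A As)
  then have "A \<in> carrier_mat (dim_row A) c" by auto
  moreover have "vcat c As \<in> carrier_mat (sum_list (map dim_row As)) c"
    using Cons.prems by (intro vcat_carrier) auto
  ultimately show ?case
    using Cons by (simp add: vcat_def mat_mult_append[of _ _ c])
qed (auto simp: vcat_def)

text \<open>At each stage the head block is split off as a corner of a four-block matrix, whose zero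
  off-diagonal blocks contribute zero vectors.\<close>

lemma diag_block_mat_mult_vec_concat:
  fixes f :: "'b \<Rightarrow> 'a::comm_ring_1 mat"
  assumes "\<And>k. k \<in> set ks \<Longrightarrow> dim_col (f k) = dim_vec (g k)"
  shows "diag_block_mat (map f ks) *\<^sub>v vec_concat (map g ks) = vec_concat (map (\<lambda>k. f k *\<^sub>v g k) ks)"
  using assms
proof (induction ks)
  case (Cons l ks)
  let ?D = "diag_block_mat (map f ks)"
  have "map (dim_col \<circ> f) ks = map (dim_vec \<circ> g) ks"
    using Cons.prems by auto
  then have D: "dim_col ?D = dim_vec (vec_concat (map g ks))"
    by (simp only: dim_diag_block_mat dim_vec_concat map_map)
  have "four_block_mat (f l) (0\<^sub>m (dim_row (f l)) (dim_col ?D)) (0\<^sub>m (dim_row ?D) (dim_col (f l))) ?D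
      *\<^sub>v (g l @\<^sub>v vec_concat (map g ks))
      = (f l *\<^sub>v g l + 0\<^sub>m (dim_row (f l)) (dim_col ?D) *\<^sub>v vec_concat (map g ks))
        @\<^sub>v (0\<^sub>m (dim_row ?D) (dim_col (f l)) *\<^sub>v g l + ?D *\<^sub>v vec_concat (map g ks))"
    using Cons.prems D by (intro four_block_mat_mult_vec) (auto intro!: carrier_vecI)
  also have "f l *\<^sub>v g l + 0\<^sub>m (dim_row (f l)) (dim_col ?D) *\<^sub>v vec_concat (map g ks) = f l *\<^sub>v g l"
    using carrier_vecI[OF D[symmetric]] D by (intro eq_vecI) auto
  also have "0\<^sub>m (dim_row ?D) (dim_col (f l)) *\<^sub>v g l + ?D *\<^sub>v vec_concat (map g ks)
      = ?D *\<^sub>v vec_concat (map g ks)"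
    using Cons.prems by (intro eq_vecI) auto
  finally have "four_block_mat (f l) (0\<^sub>m (dim_row (f l)) (dim_col ?D)) (0\<^sub>m (dim_row ?D) (dim_col (f l))) ?D
      *\<^sub>v (g l @\<^sub>v vec_concat (map g ks)) = f l *\<^sub>v g l @\<^sub>v ?D *\<^sub>v vec_concat (map g ks)" .
  then show ?case
    using Cons by (simp add: Let_def)
qed auto

lemma vectorize_hcat:
  "(\<And>A. A \<in> set As \<Longrightarrow> dim_row A = r) \<Longrightarrow> vectorize (hcat r As) = vec_concat (map vectorize As)"
proof (induction As)
  case (Cons A As)
  have "vectorize (append_cols A (hcat r As)) = vectorize A @\<^sub>v vectorize (hcat r As)"
    using Cons.prems by (intro vectorize_append_cols[of A r "dim_col A", OF _ hcat_carrier]) auto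
  then show ?case
    using Cons by (simp add: hcat_def)
next
  case Nil
  show ?case by (intro eq_vecI) (simp_all add: hcat_def)
qed

lemma cyc_suc_in: "k \<in> {1..p} \<Longrightarrow> cyc_suc p k \<in> {1..p}"
  by (auto simp: cyc_suc_def)

lemma set_upt_1: "set [1..<p + 1] = {1..p}"
  by auto

lemma sum_list_const: "(\<And>k. k \<in> set ks \<Longrightarrow> f k = c) \<Longrightarrow> sum_list (map f ks) = length ks * (c::nat)"
  by (induction ks) auto

text \<open>Serves to cancel each tolerance in \<open>H1\<close> against its reciprocal in
  \<open>u\<close>.\<close>

lemma smult_mat_mult_smult_vec:
  fixes A :: "'a::field mat"
  assumes "dim_vec v = dim_col A"
  shows "(a \<cdot>\<^sub>m A) *\<^sub>v (b \<cdot>\<^sub>v v) = (a * b) \<cdot>\<^sub>v (A *\<^sub>v v)"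
  using assms by (intro eq_vecI) (auto simp: scalar_prod_def sum_distrib_left ac_simps intro!: sum.cong)

lemma zero_mat_mult_vec: "dim_vec v = c \<Longrightarrow> 0\<^sub>m r c *\<^sub>v v = (0\<^sub>v r :: 'a::semiring_0 vec)"
  by (intro eq_vecI) (auto simp: scalar_prod_def)

lemma sum_list_two_blocks:
  fixes c :: nat
  assumes "\<And>k. k \<in> set ks \<Longrightarrow> d (P k) = c" and "\<And>k. k \<in> set ks \<Longrightarrow> d (Q k) = c"
  shows "sum_list (map d (concat (map (\<lambda>k. [P k, Q k]) ks))) = length ks * (2 * c)"
  using assms by (induction ks) auto

lemma hcat_two_blocks_carrier:
  assumes "\<And>k. k \<in> set ks \<Longrightarrow> P k \<in> carrier_mat r c" and "\<And>k. k \<in> set ks \<Longrightarrow> Q k \<in> carrier_mat r c"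
  shows "hcat r (concat (map (\<lambda>k. [P k, Q k]) ks)) \<in> carrier_mat r (length ks * (2 * c))"
proof -
  have "dim_row M = r" if "M \<in> set (concat (map (\<lambda>k. [P k, Q k]) ks))" for M
    using that assms by auto
  then have "hcat r (concat (map (\<lambda>k. [P k, Q k]) ks))
      \<in> carrier_mat r (sum_list (map dim_col (concat (map (\<lambda>k. [P k, Q k]) ks))))"
    by (rule hcat_carrier)
  also have "sum_list (map dim_col (concat (map (\<lambda>k. [P k, Q k]) ks))) = length ks * (2 * c)"
    by (rule sum_list_two_blocks) (auto dest: assms)
  finally show ?thesis .
qed

lemma vcat_two_blocks_carrier:
  assumes "\<And>k. k \<in> set ks \<Longrightarrow> P k \<in> carrier_mat r c" and "\<And>k. k \<in> set ks \<Longrightarrow> Q k \<in> carrier_mat r c"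
  shows "vcat c (concat (map (\<lambda>k. [P k, Q k]) ks)) \<in> carrier_mat (length ks * (2 * r)) c"
proof -
  have "dim_col M = c" if "M \<in> set (concat (map (\<lambda>k. [P k, Q k]) ks))" for M
    using that assms by auto
  then have "vcat c (concat (map (\<lambda>k. [P k, Q k]) ks))
      \<in> carrier_mat (sum_list (map dim_row (concat (map (\<lambda>k. [P k, Q k]) ks)))) c"
    by (rule vcat_carrier)
  also have "sum_list (map dim_row (concat (map (\<lambda>k. [P k, Q k]) ks))) = length ks * (2 * r)"
    by (rule sum_list_two_blocks) (auto dest: assms)
  finally show ?thesis .
qed

section \<open>The stacked unknowns as a single vector\<close>

lemma interleave_cols_carrier:
  assumes "X \<in> {1..p} \<rightarrow> carrier_mat m n" "Y \<in> {1..p} \<rightarrow> carrier_mat m n"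
  shows "interleave_cols p m X Y \<in> carrier_mat m (p * (2 * n))"
  using hcat_two_blocks_carrier[of "[1..<p + 1]" X m n Y, unfolded set_upt_1,
      OF funcset_mem[OF assms(1)] funcset_mem[OF assms(2)]]
  unfolding interleave_cols_def by (simp del: upt_Suc)

text \<open>Groups the \<open>2 * p\<close> vectorized blocks into one piece for each index, the
  form to which the facts about \<open>vec_concat (map f ks)\<close> apply.\<close>

lemma vectorize_interleave_cols:
  assumes "X \<in> {1..p} \<rightarrow> carrier_mat m n" "Y \<in> {1..p} \<rightarrow> carrier_mat m n"
  shows "vectorize (interleave_cols p m X Y)
    = vec_concat (map (\<lambda>k. vectorize (X k) @\<^sub>v vectorize (Y k)) [1..<p + 1])"
proof -
  have "vectorize (interleave_cols p m X Y)
      = vec_concat (map vectorize (concat (map (\<lambda>k. [X k, Y k]) [1..<p + 1])))"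
    unfolding interleave_cols_def using assms by (intro vectorize_hcat) fastforce
  then show ?thesis
    by (simp add: map_concat vec_concat_concat o_def del: upt_Suc)
qed

lemma vectorize_interleave_cols_add:
  fixes X Y :: "nat \<Rightarrow> 'a::monoid_add mat"
  assumes "X \<in> {1..p} \<rightarrow> carrier_mat m n" "Y \<in> {1..p} \<rightarrow> carrier_mat m n"
    and "X' \<in> {1..p} \<rightarrow> carrier_mat m n" "Y' \<in> {1..p} \<rightarrow> carrier_mat m n"
  shows "vectorize (interleave_cols p m X Y) + vectorize (interleave_cols p m X' Y')
    = vectorize (interleave_cols p m (\<lambda>k. X k + X' k) (\<lambda>k. Y k + Y' k))"
proof -
  have X: "(\<lambda>k. X k + X' k) \<in> {1..p} \<rightarrow> carrier_mat m n"
    by (intro funcsetI add_carrier_mat funcset_mem[OF assms(3)])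
  have Y: "(\<lambda>k. Y k + Y' k) \<in> {1..p} \<rightarrow> carrier_mat m n"
    by (intro funcsetI add_carrier_mat funcset_mem[OF assms(4)])
  have step: "(vectorize (X k) @\<^sub>v vectorize (Y k)) + (vectorize (X' k) @\<^sub>v vectorize (Y' k))
      = vectorize (X k + X' k) @\<^sub>v vectorize (Y k + Y' k)" if "k \<in> {1..p}" for k
  proof -
    have c: "X k \<in> carrier_mat m n" "Y k \<in> carrier_mat m n" "X' k \<in> carrier_mat m n" "Y' k \<in> carrier_mat m n"
      using assms that by auto
    then show ?thesis
      by (subst append_vec_add[of _ "m * n" _ _ "m * n"]) (auto simp: vectorize_add[of _ m n])
  qed
  have "dim_vec (vectorize (X k) @\<^sub>v vectorize (Y k)) = dim_vec (vectorize (X' k) @\<^sub>v vectorize (Y' k))"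
    if "k \<in> set [1..<p + 1]" for k
    using that assms unfolding set_upt_1 by (auto dest!: funcset_mem)
  then show ?thesis
    unfolding vectorize_interleave_cols[OF assms(1,2)] vectorize_interleave_cols[OF assms(3,4)]
      vectorize_interleave_cols[OF X Y]
    by (subst vec_concat_map_add) (auto simp: step simp del: upt_Suc intro!: arg_cong[of _ _ vec_concat])
qed

lemma vectorize_interleave_cols_uminus:
  fixes X Y :: "nat \<Rightarrow> 'a::group_add mat"
  assumes "X \<in> {1..p} \<rightarrow> carrier_mat m n" "Y \<in> {1..p} \<rightarrow> carrier_mat m n"
  shows "vectorize (interleave_cols p m (\<lambda>k. - X k) (\<lambda>k. - Y k)) = - vectorize (interleave_cols p m X Y)"
proof -
  have XY: "(\<lambda>k. - X k) \<in> {1..p} \<rightarrow> carrier_mat m n" "(\<lambda>k. - Y k) \<in> {1..p} \<rightarrow> carrier_mat m n"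
    using assms by auto
  have step: "vectorize (- A) = - vectorize A" for A :: "'a mat"
    by (intro eq_vecI) (auto simp: index_vectorize mod_div_less)
  have app: "- v @\<^sub>v - w = - (v @\<^sub>v w)" for v w :: "'a vec"
    by (intro eq_vecI) auto
  have "vec_concat (map (\<lambda>k. - f k) ks) = - vec_concat (map f ks)" for f :: "nat \<Rightarrow> 'a vec" and ks
    by (induction ks) (auto simp: app)
  then show ?thesis
    unfolding vectorize_interleave_cols[OF assms] vectorize_interleave_cols[OF XY] step app by simp
qed

text \<open>Injectivity is applied at three levels: the pieces of the concatenation, the two halves
  of a piece, and the entries of a half. It serves both to split the linear system into matrix
  equations and to transfer uniqueness.\<close>

lemma vectorize_interleave_cols_eq_iff:
  assumes "X \<in> {1..p} \<rightarrow> carrier_mat m n" "Y \<in> {1..p} \<rightarrow> carrier_mat m n"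
    and "X' \<in> {1..p} \<rightarrow> carrier_mat m n" "Y' \<in> {1..p} \<rightarrow> carrier_mat m n"
  shows "vectorize (interleave_cols p m X Y) = vectorize (interleave_cols p m X' Y')
    \<longleftrightarrow> (\<forall>k\<in>{1..p}. X k = X' k \<and> Y k = Y' k)"
proof
  assume eq: "vectorize (interleave_cols p m X Y) = vectorize (interleave_cols p m X' Y')"
  show "\<forall>k\<in>{1..p}. X k = X' k \<and> Y k = Y' k"
  proof
    fix k assume k: "k \<in> {1..p}"
    have c: "X k \<in> carrier_mat m n" "Y k \<in> carrier_mat m n" "X' k \<in> carrier_mat m n" "Y' k \<in> carrier_mat m n"
      if "k \<in> {1..p}" for k
      using assms that by auto
    have "vectorize (X k) @\<^sub>v vectorize (Y k) = vectorize (X' k) @\<^sub>v vectorize (Y' k)"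
    proof (rule vec_concat_map_inject[where f = "\<lambda>k. vectorize (X k) @\<^sub>v vectorize (Y k)"
          and g = "\<lambda>k. vectorize (X' k) @\<^sub>v vectorize (Y' k)"])
      show "vec_concat (map (\<lambda>k. vectorize (X k) @\<^sub>v vectorize (Y k)) [1..<p + 1])
          = vec_concat (map (\<lambda>k. vectorize (X' k) @\<^sub>v vectorize (Y' k)) [1..<p + 1])"
        using eq vectorize_interleave_cols[OF assms(1,2)] vectorize_interleave_cols[OF assms(3,4)]
        by (simp only:)
      show "k \<in> set [1..<p + 1]" using k by auto
    next
      fix l assume "l \<in> set [1..<p + 1]"
      then have "l \<in> {1..p}" unfolding set_upt_1 .
      from c[OF this]
      show "dim_vec (vectorize (X l) @\<^sub>v vectorize (Y l)) = dim_vec (vectorize (X' l) @\<^sub>v vectorize (Y' l))"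
        by auto
    qed
    then have "vectorize (X k) = vectorize (X' k) \<and> vectorize (Y k) = vectorize (Y' k)"
      using append_vec_eq[of "vectorize (X k)" "m * n" "vectorize (X' k)"] c[OF k] by blast
    then show "X k = X' k \<and> Y k = Y' k"
      using vectorize_inject[of _ m n] c[OF k] by blast
  qed
next
  assume "\<forall>k\<in>{1..p}. X k = X' k \<and> Y k = Y' k"
  then show "vectorize (interleave_cols p m X Y) = vectorize (interleave_cols p m X' Y')"
    unfolding vectorize_interleave_cols[OF assms(1,2)] vectorize_interleave_cols[OF assms(3,4)]
    by (intro arg_cong[of _ _ vec_concat] map_cong) auto
qed

text \<open>The vector is cut into \<open>p\<close> pieces, each piece into two halves of length
  \<open>m * n\<close>, and each half is read back as a matrix. This turns the vector solution of
  the linear system into matrix families.\<close>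

lemma vectorize_interleave_cols_surj:
  fixes v :: "'a::zero vec"
  assumes "v \<in> carrier_vec (2 * p * m * n)"
  obtains X Y where "X \<in> {1..p} \<rightarrow>\<^sub>E carrier_mat m n" "Y \<in> {1..p} \<rightarrow>\<^sub>E carrier_mat m n"
    and "v = vectorize (interleave_cols p m X Y)"
proof -
  have "length [1..<p + 1] * (m * n + m * n) = 2 * p * m * n"
    by (simp flip: mult_2)
  with assms have "v \<in> carrier_vec (length [1..<p + 1] * (m * n + m * n))"
    by (simp only:)
  then obtain f where f: "\<And>k. k \<in> set [1..<p + 1] \<Longrightarrow> f k \<in> carrier_vec (m * n + m * n)"
      "v = vec_concat (map f [1..<p + 1])"
    using vec_concat_map_surj[of "[1..<p + 1]"] by (metis distinct_upt)
  have "\<exists>X Y. X \<in> carrier_mat m n \<and> Y \<in> carrier_mat m n \<and> f k = vectorize X @\<^sub>v vectorize Y"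
    if "k \<in> {1..p}" for k
  proof -
    have "f k \<in> carrier_vec (m * n + m * n)"
      using f(1) that unfolding set_upt_1 by blast
    then have "vec_first (f k) (m * n) @\<^sub>v vec_last (f k) (m * n) = f k"
      by (rule vec_first_last_append)
    moreover obtain X where "X \<in> carrier_mat m n" "vec_first (f k) (m * n) = vectorize X"
      by (rule vectorize_surj[OF vec_first_carrier])
    moreover obtain Y where "Y \<in> carrier_mat m n" "vec_last (f k) (m * n) = vectorize Y"
      by (rule vectorize_surj[OF vec_last_carrier])
    ultimately show ?thesis
      by (metis (full_types))
  qed
  then obtain X Y where XY: "\<And>k. k \<in> {1..p} \<Longrightarrow> X k \<in> carrier_mat m n \<and> Y k \<in> carrier_mat m n \<and>
      f k = vectorize (X k) @\<^sub>v vectorize (Y k)"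
    by metis
  \<comment> \<open>The chosen families are arbitrary outside \<open>{1..p}\<close>; restriction
    makes them extensional, as membership in \<open>perturbed_solutions\<close> requires.\<close>
  let ?X = "restrict X {1..p}" and ?Y = "restrict Y {1..p}"
  have c: "?X \<in> {1..p} \<rightarrow>\<^sub>E carrier_mat m n" "?Y \<in> {1..p} \<rightarrow>\<^sub>E carrier_mat m n"
    using XY by auto
  have "v = vectorize (interleave_cols p m ?X ?Y)"
    using c unfolding f(2)
    by (subst vectorize_interleave_cols[of _ _ m n])
       (auto simp: XY simp del: upt_Suc intro!: arg_cong[of _ _ vec_concat])
  with c show ?thesis by (rule that)
qed

text \<open>Models a block row of \<open>W\<close>: at most one block acts on the \<open>x\<close>
  parts and one on the \<open>y\<close> parts. The positions \<open>a\<close> and \<open>b\<close>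
  are independent because \<open>C k\<close> stands in the column of the cyclic successor while
  \<open>D k\<close> stands in column \<open>k\<close>. The membership tests let the induction pass
  through lists that do not contain \<open>a\<close> or \<open>b\<close>.\<close>

lemma hcat_two_blocks_mult_vec:
  fixes P Q :: "'a::comm_ring_1 mat"
  assumes "distinct ks" and P: "P \<in> carrier_mat r c" and Q: "Q \<in> carrier_mat r c"
    and "\<And>l. l \<in> set ks \<Longrightarrow> x l \<in> carrier_vec c" and "\<And>l. l \<in> set ks \<Longrightarrow> y l \<in> carrier_vec c"
  shows "hcat r (concat (map (\<lambda>l. [if l = a then P else 0\<^sub>m r c, if l = b then Q else 0\<^sub>m r c]) ks))
      *\<^sub>v vec_concat (concat (map (\<lambda>l. [x l, y l]) ks))
    = (if a \<in> set ks then P *\<^sub>v x a else 0\<^sub>v r) + (if b \<in> set ks then Q *\<^sub>v y b else 0\<^sub>v r)"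
  using assms(1,4,5)
proof (induction ks)
  case Nil
  show ?case by (intro eq_vecI) (auto simp: hcat_def)
next
  case (Cons l ks)
  let ?P = "\<lambda>l. if l = a then P else 0\<^sub>m r c" and ?Q = "\<lambda>l. if l = b then Q else 0\<^sub>m r c"
  let ?Ms = "concat (map (\<lambda>l. [?P l, ?Q l]) ks)" and ?vs = "concat (map (\<lambda>l. [x l, y l]) ks)"
  have x: "x l \<in> carrier_vec c" and y: "y l \<in> carrier_vec c"
    using Cons.prems by auto
  have rows: "dim_row M = r" if "M \<in> set ?Ms" for M
    using that P Q by (auto split: if_splits)
  have cols: "map dim_col ?Ms = map dim_vec ?vs"
  proof -
    \<comment> \<open>Generalizing from \<open>ks\<close> to lists over the same keys keeps the
      dimension assumptions on \<open>x\<close> and \<open>y\<close> available in this inner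
      induction.\<close>
    have "map dim_col (concat (map (\<lambda>l. [?P l, ?Q l]) ls)) = map dim_vec (concat (map (\<lambda>l. [x l, y l]) ls))"
      if "set ls \<subseteq> set ks" for ls
      using that
    proof (induction ls)
      case (Cons i ls)
      have "dim_vec (x i) = c" "dim_vec (y i) = c"
        using Cons.prems \<open>\<And>l'. l' \<in> set (l # ks) \<Longrightarrow> x l' \<in> carrier_vec c\<close>
          \<open>\<And>l'. l' \<in> set (l # ks) \<Longrightarrow> y l' \<in> carrier_vec c\<close> by auto
      then show ?case using Cons P Q by auto
    qed simp
    then show ?thesis by blast
  qed
  have "hcat r (?P l # ?Q l # ?Ms) *\<^sub>v vec_concat (x l # y l # ?vs)
      = ?P l *\<^sub>v x l + hcat r (?Q l # ?Ms) *\<^sub>v vec_concat (y l # ?vs)"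
    using x y P Q rows cols by (intro hcat_mult_vec_concat) auto
  also have "hcat r (?Q l # ?Ms) *\<^sub>v vec_concat (y l # ?vs) = ?Q l *\<^sub>v y l + hcat r ?Ms *\<^sub>v vec_concat ?vs"
    using x y P Q rows cols by (intro hcat_mult_vec_concat) auto
  also have "hcat r ?Ms *\<^sub>v vec_concat ?vs
      = (if a \<in> set ks then P *\<^sub>v x a else 0\<^sub>v r) + (if b \<in> set ks then Q *\<^sub>v y b else 0\<^sub>v r)"
    using Cons by simp
  also have "?P l *\<^sub>v x l = (if l = a then P *\<^sub>v x a else 0\<^sub>v r)"
    using x by (auto simp: zero_mat_mult_vec)
  also have "?Q l *\<^sub>v y l = (if l = b then Q *\<^sub>v y b else 0\<^sub>v r)"
    using y by (auto simp: zero_mat_mult_vec)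
  \<comment> \<open>As \<open>l\<close> does not occur in \<open>ks\<close>, the head and the tail
    cannot both contribute the same block.\<close>
  also have "(if l = a then P *\<^sub>v x a else 0\<^sub>v r) + ((if l = b then Q *\<^sub>v y b else 0\<^sub>v r)
      + ((if a \<in> set ks then P *\<^sub>v x a else 0\<^sub>v r) + (if b \<in> set ks then Q *\<^sub>v y b else 0\<^sub>v r)))
    = (if a \<in> set (l # ks) then P *\<^sub>v x a else 0\<^sub>v r) + (if b \<in> set (l # ks) then Q *\<^sub>v y b else 0\<^sub>v r)"
    using P Q Cons.prems(1) by (intro eq_vecI) (auto simp del: index_mult_mat_vec)
  finally show ?case by simp
qed

section \<open>The matrices of the periodic system\<close>

lemma kron_one_left_carrier: "A \<in> carrier_mat a m \<Longrightarrow> kron (1\<^sub>m n) A \<in> carrier_mat (a * n) (m * n)"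
  using kron_carrier[OF one_carrier_mat, of A a m n] by (simp add: mult.commute)

lemma kron_one_right_carrier:
  "B \<in> carrier_mat n b \<Longrightarrow> kron (transpose_mat B) (1\<^sub>m m) \<in> carrier_mat (m * b) (m * n)"
  using kron_carrier[of "transpose_mat B" b n "1\<^sub>m m" m m] by (simp add: mult.commute)

text \<open>The dimensions of a matrix difference are by definition those of the subtrahend, so the
  product alone fixes the carrier.\<close>

lemma minus_mult_carrier:
  assumes "Y \<in> S \<rightarrow> carrier_mat m n" and "B \<in> S \<rightarrow> carrier_mat n b"
  shows "(\<lambda>k. G k - Y k * B k) \<in> S \<rightarrow> carrier_mat m b"
  by (intro funcsetI minus_carrier_mat mult_carrier_mat[OF funcset_mem[OF assms(1)] funcset_mem[OF assms(2)]])

lemma pgcs_mat_carrier: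
  assumes "A \<in> {1..p} \<rightarrow> carrier_mat m m" and "C \<in> {1..p} \<rightarrow> carrier_mat m m"
    and "B \<in> {1..p} \<rightarrow> carrier_mat n n" and "D \<in> {1..p} \<rightarrow> carrier_mat n n"
  shows "pgcs_mat p m n A B C D \<in> carrier_mat (2 * p * m * n) (2 * p * m * n)"
proof -
  have eq: "length [1..<p + 1] * (2 * (m * n)) = 2 * p * m * n"
    by simp
  have kron: "kron (1\<^sub>m n) (A k) \<in> carrier_mat (m * n) (m * n)"
    "kron (1\<^sub>m n) (C k) \<in> carrier_mat (m * n) (m * n)"
    "kron (transpose_mat (B k)) (1\<^sub>m m) \<in> carrier_mat (m * n) (m * n)"
    "kron (transpose_mat (D k)) (1\<^sub>m m) \<in> carrier_mat (m * n) (m * n)" if "k \<in> {1..p}" for k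
    using that
    by (auto intro!: kron_one_left_carrier kron_one_right_carrier funcset_mem[OF assms(1)]
        funcset_mem[OF assms(2)] funcset_mem[OF assms(3)] funcset_mem[OF assms(4)])
  show ?thesis
    unfolding pgcs_mat_def Let_def
    by (rule vcat_two_blocks_carrier[of "[1..<p + 1]" _ "m * n" "2 * p * m * n", unfolded eq];
        rule hcat_two_blocks_carrier[of "[1..<p + 1]" _ "m * n" "m * n", unfolded eq])
       (auto simp: kron simp del: upt_Suc)
qed

text \<open>Each block row selects one \<open>X\<close> and one \<open>Y\<close> from the stack, and
  the Kronecker identities turn the two products into a vectorized Sylvester expression. The result
  is applied to \<open>W\<close> and to \<open>\<Delta>W\<close> alike.\<close>

lemma pgcs_mat_mult_interleave_cols:
  assumes "A \<in> {1..p} \<rightarrow> carrier_mat m m" and "C \<in> {1..p} \<rightarrow> carrier_mat m m"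
    and "B \<in> {1..p} \<rightarrow> carrier_mat n n" and "D \<in> {1..p} \<rightarrow> carrier_mat n n"
    and "X \<in> {1..p} \<rightarrow> carrier_mat m n" and "Y \<in> {1..p} \<rightarrow> carrier_mat m n"
  shows "pgcs_mat p m n A B C D *\<^sub>v vectorize (interleave_cols p m X Y)
    = vectorize (interleave_cols p m (\<lambda>k. A k * X k - Y k * B k) (\<lambda>k. C k * X (cyc_suc p k) - Y k * D k))"
proof -
  define ks where "ks = [1..<p + 1]"
  have ks: "set ks = {1..p}" "distinct ks" "length ks * (2 * (m * n)) = 2 * p * m * n"
    unfolding ks_def by auto
  define z where "z = vec_concat (concat (map (\<lambda>l. [vectorize (X l), vectorize (Y l)]) ks))"
  have z: "vectorize (interleave_cols p m X Y) = z"
    unfolding z_def ks_def vectorize_interleave_cols[OF assms(5,6)]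
    by (simp add: vec_concat_concat o_def del: upt_Suc)
  \<comment> \<open>Common shape of both kinds of block row: \<open>P\<close> in the
    \<open>X\<close> column \<open>a\<close>, \<open>Q\<close> in the \<open>Y\<close> column
    \<open>b\<close>. Only the second kind has \<open>a\<close> different from \<open>b\<close> in
    general.\<close>
  define row where "row a b P Q = hcat (m * n) (concat (map (\<lambda>l.
      [if l = a then P else 0\<^sub>m (m * n) (m * n), if l = b then Q else 0\<^sub>m (m * n) (m * n)]) ks))"
    for a b :: nat and P Q :: "'a mat"
  define R1 where "R1 k = row k k (kron (1\<^sub>m n) (A k)) (- kron (transpose_mat (B k)) (1\<^sub>m m))" for k
  define R2 where "R2 k = row (cyc_suc p k) k (kron (1\<^sub>m n) (C k)) (- kron (transpose_mat (D k)) (1\<^sub>m m))" for k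
  have W: "pgcs_mat p m n A B C D = vcat (2 * p * m * n) (concat (map (\<lambda>k. [R1 k, R2 k]) ks))"
    unfolding pgcs_mat_def Let_def R1_def R2_def row_def ks_def ..
  have row: "row a b (kron (1\<^sub>m n) G) (- kron (transpose_mat H) (1\<^sub>m m)) \<in> carrier_mat (m * n) (2 * p * m * n)"
    "row a b (kron (1\<^sub>m n) G) (- kron (transpose_mat H) (1\<^sub>m m)) *\<^sub>v z = vectorize (G * X a - Y b * H)"
    if "G \<in> carrier_mat m m" "H \<in> carrier_mat n n" "a \<in> {1..p}" "b \<in> {1..p}" for a b G H
  proof -
    have G: "kron (1\<^sub>m n) G \<in> carrier_mat (m * n) (m * n)"
      by (rule kron_one_left_carrier[OF that(1)])
    have H: "kron (transpose_mat H) (1\<^sub>m m) \<in> carrier_mat (m * n) (m * n)"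
      by (rule kron_one_right_carrier[OF that(2)])
    show "row a b (kron (1\<^sub>m n) G) (- kron (transpose_mat H) (1\<^sub>m m)) \<in> carrier_mat (m * n) (2 * p * m * n)"
      unfolding row_def by (rule hcat_two_blocks_carrier[of ks _ "m * n" "m * n", unfolded ks(3)]) (use G H in auto)
    have X: "X a \<in> carrier_mat m n" and Y: "Y b \<in> carrier_mat m n"
      using assms that by auto
    have "row a b (kron (1\<^sub>m n) G) (- kron (transpose_mat H) (1\<^sub>m m)) *\<^sub>v z
        = kron (1\<^sub>m n) G *\<^sub>v vectorize (X a) + (- kron (transpose_mat H) (1\<^sub>m m)) *\<^sub>v vectorize (Y b)"
      unfolding row_def z_def using that(3,4)
      by (subst hcat_two_blocks_mult_vec[OF ks(2) G uminus_carrier_mat[OF H]])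
         (auto simp: ks(1) intro!: vectorize_carrier funcset_mem[OF assms(5)] funcset_mem[OF assms(6)])
    also have "\<dots> = kron (1\<^sub>m n) G *\<^sub>v vectorize (X a) + - (kron (transpose_mat H) (1\<^sub>m m) *\<^sub>v vectorize (Y b))"
      using H Y by (subst uminus_mult_mat_vec) auto
    also have "\<dots> = vectorize (G * X a) + - vectorize (Y b * H)"
      using that X Y by (simp add: kron_one_left_mult_vectorize kron_one_right_mult_vectorize)
    also have "\<dots> = vectorize (G * X a - Y b * H)"
      using that X Y by (subst vectorize_minus[of _ m n]) (auto intro!: eq_vecI)
    finally show "row a b (kron (1\<^sub>m n) G) (- kron (transpose_mat H) (1\<^sub>m m)) *\<^sub>v z = vectorize (G * X a - Y b * H)" .
  qed
  have coeffs: "A k \<in> carrier_mat m m" "B k \<in> carrier_mat n n" "C k \<in> carrier_mat m m" "D k \<in> carrier_mat n n"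
    "cyc_suc p k \<in> {1..p}" if "k \<in> {1..p}" for k
    using assms that cyc_suc_in by auto
  have R: "R1 k \<in> carrier_mat (m * n) (2 * p * m * n)" "R2 k \<in> carrier_mat (m * n) (2 * p * m * n)"
    "R1 k *\<^sub>v z = vectorize (A k * X k - Y k * B k)"
    "R2 k *\<^sub>v z = vectorize (C k * X (cyc_suc p k) - Y k * D k)" if "k \<in> {1..p}" for k
    unfolding R1_def R2_def using coeffs[OF that] that by (auto intro!: row)
  have "z \<in> carrier_vec (2 * p * m * n)"
    unfolding z[symmetric] using vectorize_carrier[OF interleave_cols_carrier[OF assms(5,6)]]
    by (simp add: ac_simps)
  then have "pgcs_mat p m n A B C D *\<^sub>v z = vec_concat (map (\<lambda>M. M *\<^sub>v z) (concat (map (\<lambda>k. [R1 k, R2 k]) ks)))"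
    unfolding W using R(1,2)[THEN carrier_matD(2)] ks(1) by (intro vcat_mult_vec) auto
  also have "\<dots> = vec_concat (map (\<lambda>k. R1 k *\<^sub>v z @\<^sub>v R2 k *\<^sub>v z) ks)"
    by (simp add: map_concat vec_concat_concat o_def)
  also have "\<dots> = vec_concat (map (\<lambda>k. vectorize (A k * X k - Y k * B k)
      @\<^sub>v vectorize (C k * X (cyc_suc p k) - Y k * D k)) ks)"
    using R(3,4) ks(1) by (intro arg_cong[of _ _ vec_concat] map_cong) auto
  also have "\<dots> = vectorize (interleave_cols p m (\<lambda>k. A k * X k - Y k * B k)
      (\<lambda>k. C k * X (cyc_suc p k) - Y k * D k))"
    unfolding ks_def
    by (rule vectorize_interleave_cols[OF minus_mult_carrier[OF assms(6,3)] minus_mult_carrier[OF assms(6,4)], symmetric])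
  finally show ?thesis
    unfolding z .
qed

section \<open>The weighted matrix \<open>H1\<close> and the vector \<open>u\<close>\<close>

lemma hcat_six_mult_vec:
  fixes A1 :: "'a::comm_ring_1 mat"
  assumes "A1 \<in> carrier_mat r (dim_vec v1)" "A2 \<in> carrier_mat r (dim_vec v2)" "A3 \<in> carrier_mat r (dim_vec v3)"
    "A4 \<in> carrier_mat r (dim_vec v4)" "A5 \<in> carrier_mat r (dim_vec v5)" "A6 \<in> carrier_mat r (dim_vec v6)"
  shows "hcat r [A1, A2, A3, A4, A5, A6] *\<^sub>v vec_concat [v1, v2, v3, v4, v5, v6]
    = A1 *\<^sub>v v1 + (A2 *\<^sub>v v2 + (A3 *\<^sub>v v3 + (A4 *\<^sub>v v4 + (A5 *\<^sub>v v5 + A6 *\<^sub>v v6))))"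
proof -
  have "hcat r [] *\<^sub>v vec_concat [] = (0\<^sub>v r :: 'a vec)"
    by (intro eq_vecI) (auto simp: hcat_def)
  then have "hcat r [A6] *\<^sub>v vec_concat [v6] = A6 *\<^sub>v v6"
    using hcat_mult_vec_concat[of A6 r v6 "[]" "[]"] assms(6) by auto
  then have "hcat r [A5, A6] *\<^sub>v vec_concat [v5, v6] = A5 *\<^sub>v v5 + A6 *\<^sub>v v6"
    using hcat_mult_vec_concat[of A5 r v5 "[A6]" "[v6]"] assms by auto
  then have "hcat r [A4, A5, A6] *\<^sub>v vec_concat [v4, v5, v6] = A4 *\<^sub>v v4 + (A5 *\<^sub>v v5 + A6 *\<^sub>v v6)"
    using hcat_mult_vec_concat[of A4 r v4 "[A5, A6]" "[v5, v6]"] assms by auto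
  then have "hcat r [A3, A4, A5, A6] *\<^sub>v vec_concat [v3, v4, v5, v6]
      = A3 *\<^sub>v v3 + (A4 *\<^sub>v v4 + (A5 *\<^sub>v v5 + A6 *\<^sub>v v6))"
    using hcat_mult_vec_concat[of A3 r v3 "[A4, A5, A6]" "[v4, v5, v6]"] assms by auto
  then have "hcat r [A2, A3, A4, A5, A6] *\<^sub>v vec_concat [v2, v3, v4, v5, v6]
      = A2 *\<^sub>v v2 + (A3 *\<^sub>v v3 + (A4 *\<^sub>v v4 + (A5 *\<^sub>v v5 + A6 *\<^sub>v v6)))"
    using hcat_mult_vec_concat[of A2 r v2 "[A3, A4, A5, A6]" "[v3, v4, v5, v6]"] assms by auto
  then show ?thesis
    using hcat_mult_vec_concat[of A1 r v1 "[A2, A3, A4, A5, A6]" "[v2, v3, v4, v5, v6]"] assms by auto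
qed

text \<open>The weights cancel and the Kronecker identities handle the first two products. It
  describes the nonzero half of either block row of a diagonal block of \<open>H1\<close>: once with
  the data of the first equation, once with those of the second and the cyclically shifted
  \<open>X\<close>.\<close>

lemma scaled_block_row_mult_vec:
  fixes a b c :: "'a::field"
  assumes X: "X \<in> carrier_mat m n" and Y: "Y \<in> carrier_mat m n"
    and A: "A \<in> carrier_mat m m" and B: "B \<in> carrier_mat n n" and E: "E \<in> carrier_mat m n"
    and nz: "a \<noteq> 0" "b \<noteq> 0" "c \<noteq> 0"
  shows "(a \<cdot>\<^sub>m kron (transpose_mat X) (1\<^sub>m m)) *\<^sub>v ((1 / a) \<cdot>\<^sub>v vectorize A)
      + (((- b) \<cdot>\<^sub>m kron (1\<^sub>m n) Y) *\<^sub>v ((1 / b) \<cdot>\<^sub>v vectorize B)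
        + ((- c) \<cdot>\<^sub>m 1\<^sub>m (m * n)) *\<^sub>v ((1 / c) \<cdot>\<^sub>v vectorize E))
    = vectorize (A * X - Y * B - E)"
proof -
  note AX = mult_carrier_mat[OF A X] and YB = mult_carrier_mat[OF Y B]
  have "(a \<cdot>\<^sub>m kron (transpose_mat X) (1\<^sub>m m)) *\<^sub>v ((1 / a) \<cdot>\<^sub>v vectorize A) = vectorize (A * X)"
    using A X nz kron_one_right_carrier[OF X, of m]
    by (subst smult_mat_mult_smult_vec) (auto simp: kron_one_right_mult_vectorize)
  moreover have "((- b) \<cdot>\<^sub>m kron (1\<^sub>m n) Y) *\<^sub>v ((1 / b) \<cdot>\<^sub>v vectorize B) = - vectorize (Y * B)"
    using Y B nz kron_one_left_carrier[OF Y, of n]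
    by (subst smult_mat_mult_smult_vec) (auto simp: kron_one_left_mult_vectorize intro!: eq_vecI)
  moreover have "((- c) \<cdot>\<^sub>m 1\<^sub>m (m * n)) *\<^sub>v ((1 / c) \<cdot>\<^sub>v vectorize E) = - vectorize E"
    using E nz one_mult_mat_vec[OF vectorize_carrier[OF E]]
    by (subst smult_mat_mult_smult_vec) (auto intro!: eq_vecI)
  moreover have "vectorize (A * X - Y * B - E) = vectorize (A * X) - vectorize (Y * B) - vectorize E"
    using vectorize_minus[OF minus_carrier_mat[OF YB] E] vectorize_minus[OF AX YB] by simp
  ultimately show ?thesis
    using A X Y B E by (auto intro!: eq_vecI)
qed

lemma hcat_six_carrier:
  assumes "A1 \<in> carrier_mat r c1" "A2 \<in> carrier_mat r c2" "A3 \<in> carrier_mat r c3"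
    "A4 \<in> carrier_mat r c4" "A5 \<in> carrier_mat r c5" "A6 \<in> carrier_mat r c6"
  shows "hcat r [A1, A2, A3, A4, A5, A6] \<in> carrier_mat r (c1 + (c2 + (c3 + (c4 + (c5 + c6)))))"
proof -
  have "dim_row M = r" if "M \<in> set [A1, A2, A3, A4, A5, A6]" for M
    using that assms by auto
  then have "hcat r [A1, A2, A3, A4, A5, A6] \<in> carrier_mat r (sum_list (map dim_col [A1, A2, A3, A4, A5, A6]))"
    by (rule hcat_carrier)
  then show ?thesis
    using assms by simp
qed

lemma pgcs_H_block:
  fixes X Y :: "nat \<Rightarrow> 'a::field mat"
  assumes X: "X k \<in> carrier_mat m n" "X (cyc_suc p k) \<in> carrier_mat m n" and Y: "Y k \<in> carrier_mat m n"
    and A: "A \<in> carrier_mat m m" and B: "B \<in> carrier_mat n n" and E: "E \<in> carrier_mat m n"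
    and C: "C \<in> carrier_mat m m" and D: "D \<in> carrier_mat n n" and F: "F \<in> carrier_mat m n"
    and nz: "\<alpha> k \<noteq> 0" "\<beta> k \<noteq> 0" "\<gamma> k \<noteq> 0" "\<zeta> k \<noteq> 0" "\<tau> k \<noteq> 0" "\<delta> k \<noteq> 0"
  shows "pgcs_H_block p m n \<alpha> \<beta> \<gamma> \<zeta> \<tau> \<delta> X Y k \<in> carrier_mat (2 * (m * n)) (2 * (m * m + n * n + m * n))"
      (is "?carrier")
    and "pgcs_H_block p m n \<alpha> \<beta> \<gamma> \<zeta> \<tau> \<delta> X Y k *\<^sub>v vec_concat
      [(1 / \<alpha> k) \<cdot>\<^sub>v vectorize A, (1 / \<beta> k) \<cdot>\<^sub>v vectorize B, (1 / \<gamma> k) \<cdot>\<^sub>v vectorize E,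
       (1 / \<zeta> k) \<cdot>\<^sub>v vectorize C, (1 / \<tau> k) \<cdot>\<^sub>v vectorize D, (1 / \<delta> k) \<cdot>\<^sub>v vectorize F]
    = vectorize (A * X k - Y k * B - E) @\<^sub>v vectorize (C * X (cyc_suc p k) - Y k * D - F)"
      (is "_ *\<^sub>v ?u = ?v1 @\<^sub>v ?v2")
proof -
  let ?R1 = "[\<alpha> k \<cdot>\<^sub>m kron (transpose_mat (X k)) (1\<^sub>m m), (- \<beta> k) \<cdot>\<^sub>m kron (1\<^sub>m n) (Y k),
         (- \<gamma> k) \<cdot>\<^sub>m 1\<^sub>m (m * n),
         0\<^sub>m (m * n) (m * m), 0\<^sub>m (m * n) (n * n), 0\<^sub>m (m * n) (m * n)]"
  let ?R2 = "[0\<^sub>m (m * n) (m * m), 0\<^sub>m (m * n) (n * n), 0\<^sub>m (m * n) (m * n),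
         \<zeta> k \<cdot>\<^sub>m kron (transpose_mat (X (cyc_suc p k))) (1\<^sub>m m), (- \<tau> k) \<cdot>\<^sub>m kron (1\<^sub>m n) (Y k),
         (- \<delta> k) \<cdot>\<^sub>m 1\<^sub>m (m * n)]"
  let ?c = "2 * (m * m + n * n + m * n)"
  note c = kron_one_right_carrier[OF X(1), of m] kron_one_right_carrier[OF X(2), of m]
    kron_one_left_carrier[OF Y, of n]
  have v: "?v1 \<in> carrier_vec (m * n)" "?v2 \<in> carrier_vec (m * n)"
    using E F by (auto intro!: vectorize_carrier)
  have dims: "dim_vec (vectorize A) = m * m" "dim_vec (vectorize B) = n * n" "dim_vec (vectorize E) = m * n"
    "dim_vec (vectorize C) = m * m" "dim_vec (vectorize D) = n * n" "dim_vec (vectorize F) = m * n"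
    using A B C D E F by auto
  have u: "?u \<in> carrier_vec ?c"
    using dims by (intro carrier_vecI) (simp del: dim_vectorize)
  \<comment> \<open>In the first block row the zero blocks come last; this dimension fact lets the
    resulting zero vector be absorbed on the right of the third product.\<close>
  have e: "(- \<gamma> k \<cdot>\<^sub>m 1\<^sub>m (m * n)) *\<^sub>v ((1 / \<gamma> k) \<cdot>\<^sub>v vectorize E) \<in> carrier_vec (m * n)"
    by (intro carrier_vecI) simp
  have R1: "hcat (m * n) ?R1 *\<^sub>v ?u = ?v1"
    using dims c v(1) e
    by (subst hcat_six_mult_vec)
       (auto simp: scaled_block_row_mult_vec[OF X(1) Y A B E nz(1-3)] zero_mat_mult_vec simp del: dim_vectorize)
  have R2: "hcat (m * n) ?R2 *\<^sub>v ?u = ?v2"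
    using dims c v(2)
    by (subst hcat_six_mult_vec)
       (auto simp: scaled_block_row_mult_vec[OF X(2) Y C D F nz(4-6)] zero_mat_mult_vec simp del: dim_vectorize)
  have "m * m + (n * n + (m * n + (m * m + (n * n + m * n)))) = ?c"
    by simp
  note hcat_c = hcat_six_carrier[of _ _ "m * m" _ "n * n" _ "m * n" _ "m * m" _ "n * n" _ "m * n", unfolded this]
  have R: "hcat (m * n) ?R1 \<in> carrier_mat (m * n) ?c" "hcat (m * n) ?R2 \<in> carrier_mat (m * n) ?c"
    by (rule hcat_c; use c in simp)+
  have "dim_col M = ?c" if "M \<in> set [hcat (m * n) ?R1, hcat (m * n) ?R2]" for M
    using that R[THEN carrier_matD(2)] by auto
  note rows = this
  have "vcat ?c [hcat (m * n) ?R1, hcat (m * n) ?R2]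
      \<in> carrier_mat (sum_list (map dim_row [hcat (m * n) ?R1, hcat (m * n) ?R2])) ?c"
    by (rule vcat_carrier) (rule rows)
  also have "sum_list (map dim_row [hcat (m * n) ?R1, hcat (m * n) ?R2]) = 2 * (m * n)"
    using R[THEN carrier_matD(1)] by simp
  finally show ?carrier
    unfolding pgcs_H_block_def .
  have "vcat ?c [hcat (m * n) ?R1, hcat (m * n) ?R2] *\<^sub>v ?u
      = vec_concat (map (\<lambda>M. M *\<^sub>v ?u) [hcat (m * n) ?R1, hcat (m * n) ?R2])"
    by (rule vcat_mult_vec[OF _ u]) (rule rows)
  also have "\<dots> = ?v1 @\<^sub>v ?v2"
    unfolding list.map R1 R2 by simp
  finally show "pgcs_H_block p m n \<alpha> \<beta> \<gamma> \<zeta> \<tau> \<delta> X Y k *\<^sub>v ?u = ?v1 @\<^sub>v ?v2"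
    unfolding pgcs_H_block_def .
qed

section \<open>From one perturbed matrix equation to the global identities\<close>

text \<open>Both products are expanded and \<open>A * X - Y * B\<close> cancels against
  \<open>E\<close>. The second-order terms stay on the side of the unknowns, so the equivalence is
  exact rather than a first-order approximation.\<close>

lemma perturbed_sylvester_iff:
  fixes A :: "'a::comm_ring_1 mat"
  assumes A: "A \<in> carrier_mat m m" and A': "A' \<in> carrier_mat m m"
    and B: "B \<in> carrier_mat n n" and B': "B' \<in> carrier_mat n n"
    and X: "X \<in> carrier_mat m n" and X': "X' \<in> carrier_mat m n"
    and Y: "Y \<in> carrier_mat m n" and Y': "Y' \<in> carrier_mat m n"
    and E': "E' \<in> carrier_mat m n" and eq: "A * X - Y * B = E"
  shows "(A + A') * (X + X') - (Y + Y') * (B + B') = E + E'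
    \<longleftrightarrow> (A * X' - Y' * B) + (A' * X' - Y' * B') = - (A' * X - Y * B' - E')"
proof -
  \<comment> \<open>A purely additive identity, checked entrywise. \<open>P\<close>,
    \<open>Q\<close>, \<open>R\<close>, \<open>S\<close> stand for \<open>A * X\<close>,
    \<open>A' * X\<close>, \<open>A * X'\<close>, \<open>A' * X'\<close>, and \<open>P'\<close>,
    \<open>Q'\<close>, \<open>R'\<close>, \<open>S'\<close> for \<open>Y * B\<close>,
    \<open>Y' * B\<close>, \<open>Y * B'\<close>, \<open>Y' * B'\<close>.\<close>
  have lin: "(P + Q + (R + S)) - (P' + Q' + (R' + S')) = P - P' + G
      \<longleftrightarrow> (R - Q') + (S - S') = - (Q - R' - G)"
    if "P \<in> carrier_mat m n" "Q \<in> carrier_mat m n" "R \<in> carrier_mat m n" "S \<in> carrier_mat m n"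
      "P' \<in> carrier_mat m n" "Q' \<in> carrier_mat m n" "R' \<in> carrier_mat m n" "S' \<in> carrier_mat m n"
      "G \<in> carrier_mat m n" for P Q R S P' Q' R' S' G :: "'a mat"
  proof -
    have "p + q + (r + s) - (p' + q' + (r' + s')) = p - p' + g \<longleftrightarrow> (r - q') + (s - s') = - (q - r' - g)"
      for p q r s p' q' r' s' g :: 'a
      by (auto simp: algebra_simps)
    then show ?thesis
      using that by (auto simp: mat_eq_iff)
  qed
  note AX = mult_carrier_mat[OF A X] mult_carrier_mat[OF A X'] mult_carrier_mat[OF A' X] mult_carrier_mat[OF A' X']
  note YB = mult_carrier_mat[OF Y B] mult_carrier_mat[OF Y' B] mult_carrier_mat[OF Y B'] mult_carrier_mat[OF Y' B']
  have "(A + A') * (X + X') = A * X + A' * X + (A * X' + A' * X')"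
    using A A' X X' by (simp add: mult_add_distrib_mat[of _ m m] add_mult_distrib_mat[of _ m m])
  moreover have "(Y + Y') * (B + B') = Y * B + Y' * B + (Y * B' + Y' * B')"
    using B B' Y Y' by (simp add: mult_add_distrib_mat[of _ m n] add_mult_distrib_mat[of _ m n])
  ultimately show ?thesis
    unfolding eq[symmetric]
    by (simp only: lin[OF AX(1,3,2,4) YB(1,2,3,4) E'])
qed

text \<open>\<open>H1\<close> is block diagonal and \<open>u\<close> is cut into segments of
  matching length, so everything is computed one index at a time. The product collects the terms of
  the perturbed equations that are free of the unknowns.\<close>

lemma pgcs_H_carrier_and_mult_pgcs_u:
  fixes X Y :: "nat \<Rightarrow> 'a::field mat"
  assumes X: "X \<in> {1..p} \<rightarrow> carrier_mat m n" and Y: "Y \<in> {1..p} \<rightarrow> carrier_mat m n"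
    and A: "A \<in> {1..p} \<rightarrow> carrier_mat m m" and C: "C \<in> {1..p} \<rightarrow> carrier_mat m m"
    and B: "B \<in> {1..p} \<rightarrow> carrier_mat n n" and D: "D \<in> {1..p} \<rightarrow> carrier_mat n n"
    and E: "E \<in> {1..p} \<rightarrow> carrier_mat m n" and F: "F \<in> {1..p} \<rightarrow> carrier_mat m n"
    and nz: "\<And>k. k \<in> {1..p} \<Longrightarrow> \<alpha> k \<noteq> 0 \<and> \<beta> k \<noteq> 0 \<and> \<gamma> k \<noteq> 0 \<and> \<zeta> k \<noteq> 0 \<and> \<tau> k \<noteq> 0 \<and> \<delta> k \<noteq> 0"
  shows "pgcs_H p m n \<alpha> \<beta> \<gamma> \<zeta> \<tau> \<delta> X Y \<in> carrier_mat (2 * p * m * n) (p * (2 * (m * m + n * n + m * n)))"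
    and "pgcs_u p \<alpha> \<beta> \<gamma> \<zeta> \<tau> \<delta> A B C D E F \<in> carrier_vec (p * (2 * (m * m + n * n + m * n)))"
    and "pgcs_H p m n \<alpha> \<beta> \<gamma> \<zeta> \<tau> \<delta> X Y *\<^sub>v pgcs_u p \<alpha> \<beta> \<gamma> \<zeta> \<tau> \<delta> A B C D E F
      = vectorize (interleave_cols p m (\<lambda>k. A k * X k - Y k * B k - E k)
          (\<lambda>k. C k * X (cyc_suc p k) - Y k * D k - F k))"
proof -
  let ?c = "2 * (m * m + n * n + m * n)"
  define ks where "ks = [1..<p + 1]"
  have ks: "set ks = {1..p}" "length ks = p"
    unfolding ks_def by auto
  define H where "H = pgcs_H_block p m n \<alpha> \<beta> \<gamma> \<zeta> \<tau> \<delta> X Y"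
  define us where "us k = vec_concat [(1 / \<alpha> k) \<cdot>\<^sub>v vectorize (A k), (1 / \<beta> k) \<cdot>\<^sub>v vectorize (B k),
      (1 / \<gamma> k) \<cdot>\<^sub>v vectorize (E k), (1 / \<zeta> k) \<cdot>\<^sub>v vectorize (C k),
      (1 / \<tau> k) \<cdot>\<^sub>v vectorize (D k), (1 / \<delta> k) \<cdot>\<^sub>v vectorize (F k)]" for k
  have pgcs_H: "pgcs_H p m n \<alpha> \<beta> \<gamma> \<zeta> \<tau> \<delta> X Y = diag_block_mat (map H ks)"
    unfolding pgcs_H_def H_def ks_def ..
  have pgcs_u: "pgcs_u p \<alpha> \<beta> \<gamma> \<zeta> \<tau> \<delta> A B C D E F = vec_concat (map us ks)"
    unfolding pgcs_u_def us_def vec_concat_concat ks_def by (simp only: map_map o_def)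
  have H: "H k \<in> carrier_mat (2 * (m * n)) ?c"
    and Hu: "H k *\<^sub>v us k = vectorize (A k * X k - Y k * B k - E k)
        @\<^sub>v vectorize (C k * X (cyc_suc p k) - Y k * D k - F k)"
    and us: "us k \<in> carrier_vec ?c" if k: "k \<in> {1..p}" for k
  proof -
    have n: "\<alpha> k \<noteq> 0" "\<beta> k \<noteq> 0" "\<gamma> k \<noteq> 0" "\<zeta> k \<noteq> 0" "\<tau> k \<noteq> 0" "\<delta> k \<noteq> 0"
      using nz[OF k] by auto
    note c = funcset_mem[OF X k] funcset_mem[OF X cyc_suc_in[OF k]] funcset_mem[OF Y k]
      funcset_mem[OF A k] funcset_mem[OF B k] funcset_mem[OF E k]
      funcset_mem[OF C k] funcset_mem[OF D k] funcset_mem[OF F k]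
    show "H k \<in> carrier_mat (2 * (m * n)) ?c"
      unfolding H_def by (rule pgcs_H_block(1)[where X = X and Y = Y and k = k and p = p and \<alpha> = \<alpha> and \<beta> = \<beta> and \<gamma> = \<gamma> and \<zeta> = \<zeta> and \<tau> = \<tau> and \<delta> = \<delta>, OF c n])
    show "H k *\<^sub>v us k = vectorize (A k * X k - Y k * B k - E k)
        @\<^sub>v vectorize (C k * X (cyc_suc p k) - Y k * D k - F k)"
      unfolding H_def us_def
      by (rule pgcs_H_block(2)[where X = X and Y = Y and k = k and p = p and \<alpha> = \<alpha> and \<beta> = \<beta> and \<gamma> = \<gamma> and \<zeta> = \<zeta> and \<tau> = \<tau> and \<delta> = \<delta>, OF c n])
    show "us k \<in> carrier_vec ?c"
      unfolding us_def using c by (intro carrier_vecI) auto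
  qed
  have "sum_list (map (\<lambda>k. dim_row (H k)) ks) = length ks * (2 * (m * n))"
    using H by (intro sum_list_const) (auto simp: ks(1))
  moreover have "sum_list (map (\<lambda>k. dim_col (H k)) ks) = length ks * ?c"
    using H by (intro sum_list_const) (auto simp: ks(1))
  ultimately show "pgcs_H p m n \<alpha> \<beta> \<gamma> \<zeta> \<tau> \<delta> X Y \<in> carrier_mat (2 * p * m * n) (p * ?c)"
    unfolding pgcs_H by (intro carrier_matI) (simp_all add: dim_diag_block_mat ks(2) o_def)
  show "pgcs_u p \<alpha> \<beta> \<gamma> \<zeta> \<tau> \<delta> A B C D E F \<in> carrier_vec (p * ?c)"
    unfolding pgcs_u using vec_concat_map_carrier[of ks us ?c] us ks by simp
  have G1: "(\<lambda>k. A k * X k - Y k * B k - E k) \<in> {1..p} \<rightarrow> carrier_mat m n"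
    by (intro funcsetI minus_carrier_mat funcset_mem[OF E])
  have G2: "(\<lambda>k. C k * X (cyc_suc p k) - Y k * D k - F k) \<in> {1..p} \<rightarrow> carrier_mat m n"
    by (intro funcsetI minus_carrier_mat funcset_mem[OF F])
  have "diag_block_mat (map H ks) *\<^sub>v vec_concat (map us ks) = vec_concat (map (\<lambda>k. H k *\<^sub>v us k) ks)"
  proof (rule diag_block_mat_mult_vec_concat)
    fix k assume "k \<in> set ks"
    then have "k \<in> {1..p}" using ks(1) by simp
    then show "dim_col (H k) = dim_vec (us k)"
      using H us by (metis carrier_matD(2) carrier_vecD)
  qed
  also have "\<dots> = vec_concat (map (\<lambda>k. vectorize (A k * X k - Y k * B k - E k)
        @\<^sub>v vectorize (C k * X (cyc_suc p k) - Y k * D k - F k)) ks)"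
    using Hu ks(1) by (intro arg_cong[of _ _ vec_concat] map_cong) auto
  also have "\<dots> = vectorize (interleave_cols p m (\<lambda>k. A k * X k - Y k * B k - E k)
          (\<lambda>k. C k * X (cyc_suc p k) - Y k * D k - F k))"
    unfolding ks_def by (rule vectorize_interleave_cols[symmetric, OF G1 G2])
  finally show "pgcs_H p m n \<alpha> \<beta> \<gamma> \<zeta> \<tau> \<delta> X Y *\<^sub>v pgcs_u p \<alpha> \<beta> \<gamma> \<zeta> \<tau> \<delta> A B C D E F
      = vectorize (interleave_cols p m (\<lambda>k. A k * X k - Y k * B k - E k)
          (\<lambda>k. C k * X (cyc_suc p k) - Y k * D k - F k))"
    unfolding pgcs_H pgcs_u .
qed

text \<open>Squared norms add under concatenation, and each reciprocal weight comes out squared;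
  this identifies the radicand in the second bound.\<close>

lemma vec_norm2_pgcs_u_power2:
  "(vec_norm2 (pgcs_u p \<alpha> \<beta> \<gamma> \<zeta> \<tau> \<delta> A B C D E F))\<^sup>2
    = (\<Sum>k = 1..p. (frob_norm (A k))\<^sup>2 / (\<alpha> k)\<^sup>2 + (frob_norm (B k))\<^sup>2 / (\<beta> k)\<^sup>2
        + (frob_norm (E k))\<^sup>2 / (\<gamma> k)\<^sup>2 + (frob_norm (C k))\<^sup>2 / (\<zeta> k)\<^sup>2
        + (frob_norm (D k))\<^sup>2 / (\<tau> k)\<^sup>2 + (frob_norm (F k))\<^sup>2 / (\<delta> k)\<^sup>2)"
proof -
  have scale: "(vec_norm2 ((1 / a) \<cdot>\<^sub>v vectorize M))\<^sup>2 = (frob_norm M)\<^sup>2 / a\<^sup>2" for a M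
    by (simp add: vec_norm2_smult vec_norm2_vectorize power_divide power_mult_distrib)
  have "(vec_norm2 (pgcs_u p \<alpha> \<beta> \<gamma> \<zeta> \<tau> \<delta> A B C D E F))\<^sup>2
    = (\<Sum>k\<leftarrow>[1..<p + 1]. (frob_norm (A k))\<^sup>2 / (\<alpha> k)\<^sup>2 + (frob_norm (B k))\<^sup>2 / (\<beta> k)\<^sup>2
        + (frob_norm (E k))\<^sup>2 / (\<gamma> k)\<^sup>2 + (frob_norm (C k))\<^sup>2 / (\<zeta> k)\<^sup>2
        + (frob_norm (D k))\<^sup>2 / (\<tau> k)\<^sup>2 + (frob_norm (F k))\<^sup>2 / (\<delta> k)\<^sup>2)"
    unfolding pgcs_u_def vec_concat_concat vec_norm2_vec_concat_power2
    by (simp del: upt_Suc vec_concat_Cons vec_concat_Nil add: o_def vec_norm2_vec_concat_power2 scale add.assoc)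
  then show ?thesis
    by (simp add: sum_list_distinct_conv_sum_set atLeastLessThanSuc_atLeastAtMost del: upt_Suc)
qed

section \<open>The perturbed system\<close>

text \<open>\<open>perturbed_sylvester_iff\<close> rewrites both equations for each index, and
  injectivity of stacking merges them into one vector equation. Existence, uniqueness and size of
  the solution thereby become questions about a linear system.\<close>

lemma perturbed_solutions_iff:
  assumes A: "A \<in> {1..p} \<rightarrow> carrier_mat m m" and C: "C \<in> {1..p} \<rightarrow> carrier_mat m m"
    and B: "B \<in> {1..p} \<rightarrow> carrier_mat n n" and D: "D \<in> {1..p} \<rightarrow> carrier_mat n n"
    and X: "X \<in> {1..p} \<rightarrow> carrier_mat m n" and Y: "Y \<in> {1..p} \<rightarrow> carrier_mat m n"
    and A': "A' \<in> {1..p} \<rightarrow> carrier_mat m m" and C': "C' \<in> {1..p} \<rightarrow> carrier_mat m m"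
    and B': "B' \<in> {1..p} \<rightarrow> carrier_mat n n" and D': "D' \<in> {1..p} \<rightarrow> carrier_mat n n"
    and E': "E' \<in> {1..p} \<rightarrow> carrier_mat m n" and F': "F' \<in> {1..p} \<rightarrow> carrier_mat m n"
    and eq: "pgcs_eq p A B C D E F X Y"
    and X': "X' \<in> {1..p} \<rightarrow>\<^sub>E carrier_mat m n" and Y': "Y' \<in> {1..p} \<rightarrow>\<^sub>E carrier_mat m n"
  shows "(X', Y') \<in> perturbed_solutions p m n A B C D E F A' B' C' D' E' F' X Y
    \<longleftrightarrow> (pgcs_mat p m n A B C D + pgcs_mat p m n A' B' C' D') *\<^sub>v vectorize (interleave_cols p m X' Y')
      = - vectorize (interleave_cols p m (\<lambda>k. A' k * X k - Y k * B' k - E' k)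
          (\<lambda>k. C' k * X (cyc_suc p k) - Y k * D' k - F' k))"
    (is "_ \<longleftrightarrow> (?W + ?V) *\<^sub>v ?z = - vectorize (interleave_cols p m ?G ?H)")
proof -
  have X'Y': "X' \<in> {1..p} \<rightarrow> carrier_mat m n" "Y' \<in> {1..p} \<rightarrow> carrier_mat m n"
    using X' Y' by (auto simp: PiE_def)
  have z: "?z \<in> carrier_vec (2 * p * m * n)"
    using vectorize_carrier[OF interleave_cols_carrier[OF X'Y']] by (simp add: ac_simps)
  have G: "?G \<in> {1..p} \<rightarrow> carrier_mat m n"
    by (intro funcsetI minus_carrier_mat funcset_mem[OF E'])
  have H: "?H \<in> {1..p} \<rightarrow> carrier_mat m n"
    by (intro funcsetI minus_carrier_mat funcset_mem[OF F'])
  have nG: "(\<lambda>k. - ?G k) \<in> {1..p} \<rightarrow> carrier_mat m n"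
    by (intro funcsetI) (simp only: uminus_carrier_mat funcset_mem[OF G])
  have nH: "(\<lambda>k. - ?H k) \<in> {1..p} \<rightarrow> carrier_mat m n"
    by (intro funcsetI) (simp only: uminus_carrier_mat funcset_mem[OF H])
  note S = minus_mult_carrier[OF X'Y'(2) B] minus_mult_carrier[OF X'Y'(2) D]
    minus_mult_carrier[OF X'Y'(2) B'] minus_mult_carrier[OF X'Y'(2) D']
  \<comment> \<open>In \<open>?L1\<close> and \<open>?L2\<close> the first summand comes from
    \<open>?W\<close> and the second from \<open>?V\<close>, grouped as on the right of
    \<open>perturbed_sylvester_iff\<close>.\<close>
  let ?L1 = "\<lambda>k. (A k * X' k - Y' k * B k) + (A' k * X' k - Y' k * B' k)"
  let ?L2 = "\<lambda>k. (C k * X' (cyc_suc p k) - Y' k * D k) + (C' k * X' (cyc_suc p k) - Y' k * D' k)"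
  have L1: "?L1 \<in> {1..p} \<rightarrow> carrier_mat m n"
    by (intro funcsetI add_carrier_mat funcset_mem[OF S(3)])
  have L2: "?L2 \<in> {1..p} \<rightarrow> carrier_mat m n"
    by (intro funcsetI add_carrier_mat funcset_mem[OF S(4)])
  have "(?W + ?V) *\<^sub>v ?z = ?W *\<^sub>v ?z + ?V *\<^sub>v ?z"
    by (rule add_mult_distrib_mat_vec[OF pgcs_mat_carrier[OF A C B D] pgcs_mat_carrier[OF A' C' B' D'] z])
  also have "\<dots> = vectorize (interleave_cols p m ?L1 ?L2)"
    unfolding pgcs_mat_mult_interleave_cols[OF A C B D X'Y'] pgcs_mat_mult_interleave_cols[OF A' C' B' D' X'Y']
    by (rule vectorize_interleave_cols_add[OF S])
  finally have "(?W + ?V) *\<^sub>v ?z = - vectorize (interleave_cols p m ?G ?H)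
      \<longleftrightarrow> (\<forall>k\<in>{1..p}. ?L1 k = - ?G k \<and> ?L2 k = - ?H k)"
    by (simp only: vectorize_interleave_cols_uminus[OF G H, symmetric]
        vectorize_interleave_cols_eq_iff[OF L1 L2 nG nH])
  moreover have "(A k + A' k) * (X k + X' k) - (Y k + Y' k) * (B k + B' k) = E k + E' k \<longleftrightarrow> ?L1 k = - ?G k"
    and "(C k + C' k) * (X (cyc_suc p k) + X' (cyc_suc p k)) - (Y k + Y' k) * (D k + D' k) = F k + F' k
      \<longleftrightarrow> ?L2 k = - ?H k"
    if k: "k \<in> {1..p}" for k
  proof -
    have eq_k: "A k * X k - Y k * B k = E k" "C k * X (cyc_suc p k) - Y k * D k = F k"
      using eq k by (auto simp: pgcs_eq_def)
    show "(A k + A' k) * (X k + X' k) - (Y k + Y' k) * (B k + B' k) = E k + E' k \<longleftrightarrow> ?L1 k = - ?G k"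
      by (rule perturbed_sylvester_iff[OF funcset_mem[OF A k] funcset_mem[OF A' k] funcset_mem[OF B k]
          funcset_mem[OF B' k] funcset_mem[OF X k] funcset_mem[OF X'Y'(1) k] funcset_mem[OF Y k]
          funcset_mem[OF X'Y'(2) k] funcset_mem[OF E' k] eq_k(1)])
    show "(C k + C' k) * (X (cyc_suc p k) + X' (cyc_suc p k)) - (Y k + Y' k) * (D k + D' k) = F k + F' k
      \<longleftrightarrow> ?L2 k = - ?H k"
      by (rule perturbed_sylvester_iff[OF funcset_mem[OF C k] funcset_mem[OF C' k] funcset_mem[OF D k]
          funcset_mem[OF D' k] funcset_mem[OF X cyc_suc_in[OF k]] funcset_mem[OF X'Y'(1) cyc_suc_in[OF k]]
          funcset_mem[OF Y k] funcset_mem[OF X'Y'(2) k] funcset_mem[OF F' k] eq_k(2)])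
  qed
  ultimately show ?thesis
    using X' Y' by (simp add: perturbed_solutions_def pgcs_eq_def)
qed

section \<open>Existence, uniqueness and the three norm bounds\<close>

theorem theorem4p1:
  fixes p m n :: nat
    and A B C D E F X Y \<Delta>A \<Delta>B \<Delta>C \<Delta>D \<Delta>E \<Delta>F :: "nat \<Rightarrow> real mat"
    and \<alpha> \<beta> \<gamma> \<zeta> \<tau> \<delta> :: "nat \<Rightarrow> real"
    and W Winv \<Delta>W H1 :: "real mat" and u :: "real vec" and \<epsilon> :: real
    and S :: "((nat \<Rightarrow> real mat) \<times> (nat \<Rightarrow> real mat)) set"
  assumes "p \<ge> 1" and "m \<ge> 1" and "n \<ge> 1"
    and "A \<in> {1..p} \<rightarrow> carrier_mat m m" and "C \<in> {1..p} \<rightarrow> carrier_mat m m"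
    and "B \<in> {1..p} \<rightarrow> carrier_mat n n" and "D \<in> {1..p} \<rightarrow> carrier_mat n n"
    and "E \<in> {1..p} \<rightarrow> carrier_mat m n" and "F \<in> {1..p} \<rightarrow> carrier_mat m n"
    and "X \<in> {1..p} \<rightarrow> carrier_mat m n" and "Y \<in> {1..p} \<rightarrow> carrier_mat m n"
    and "\<Delta>A \<in> {1..p} \<rightarrow> carrier_mat m m" and "\<Delta>C \<in> {1..p} \<rightarrow> carrier_mat m m"
    and "\<Delta>B \<in> {1..p} \<rightarrow> carrier_mat n n" and "\<Delta>D \<in> {1..p} \<rightarrow> carrier_mat n n"
    and "\<Delta>E \<in> {1..p} \<rightarrow> carrier_mat m n" and "\<Delta>F \<in> {1..p} \<rightarrow> carrier_mat m n"
    and "\<And>k. k \<in> {1..p} \<Longrightarrow> \<alpha> k > 0 \<and> \<beta> k > 0 \<and> \<gamma> k > 0 \<and> \<zeta> k > 0 \<and> \<tau> k > 0 \<and> \<delta> k > 0"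
    and W: "W = pgcs_mat p m n A B C D"
    and \<Delta>W: "\<Delta>W = pgcs_mat p m n \<Delta>A \<Delta>B \<Delta>C \<Delta>D"
    and H1: "H1 = pgcs_H p m n \<alpha> \<beta> \<gamma> \<zeta> \<tau> \<delta> X Y"
    and u: "u = pgcs_u p \<alpha> \<beta> \<gamma> \<zeta> \<tau> \<delta> \<Delta>A \<Delta>B \<Delta>C \<Delta>D \<Delta>E \<Delta>F"
    and \<epsilon>: "\<epsilon> = Max ((\<lambda>k. Max {frob_norm (\<Delta>A k) / \<alpha> k, frob_norm (\<Delta>B k) / \<beta> k,
                            frob_norm (\<Delta>E k) / \<gamma> k, frob_norm (\<Delta>C k) / \<zeta> k,
                            frob_norm (\<Delta>D k) / \<tau> k, frob_norm (\<Delta>F k) / \<delta> k}) ` {1..p})"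
    and S: "S = perturbed_solutions p m n A B C D E F \<Delta>A \<Delta>B \<Delta>C \<Delta>D \<Delta>E \<Delta>F X Y"
    and "pgcs_eq p A B C D E F X Y"
    and "invertible_mat W"
    and Winv: "Winv = the (mat_inverse W)"
    and "spec_norm (Winv * \<Delta>W) < 1"
  shows "(\<exists>!Z. Z \<in> S) \<and>
    (\<forall>(\<Delta>X, \<Delta>Y) \<in> S.
       frob_norm (interleave_cols p m \<Delta>X \<Delta>Y)
         \<le> vec_norm2 (Winv * H1 *\<^sub>v u) / (1 - spec_norm (Winv * \<Delta>W)) \<and>
       vec_norm2 (Winv * H1 *\<^sub>v u) / (1 - spec_norm (Winv * \<Delta>W))
         \<le> spec_norm (Winv * H1)
             * sqrt (\<Sum>i = 1..p. (frob_norm (\<Delta>A i))\<^sup>2 / (\<alpha> i)\<^sup>2 + (frob_norm (\<Delta>B i))\<^sup>2 / (\<beta> i)\<^sup>2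
                              + (frob_norm (\<Delta>E i))\<^sup>2 / (\<gamma> i)\<^sup>2 + (frob_norm (\<Delta>C i))\<^sup>2 / (\<zeta> i)\<^sup>2
                              + (frob_norm (\<Delta>D i))\<^sup>2 / (\<tau> i)\<^sup>2 + (frob_norm (\<Delta>F i))\<^sup>2 / (\<delta> i)\<^sup>2)
             / (1 - spec_norm (Winv * \<Delta>W)) \<and>
       frob_norm (interleave_cols p m \<Delta>X \<Delta>Y)
         \<le> sqrt (6 * real p) * spec_norm (Winv * H1) * \<epsilon> / (1 - spec_norm (Winv * \<Delta>W)))"
proof -
  have p: "1 \<le> p"
    and A: "A \<in> {1..p} \<rightarrow> carrier_mat m m" and C: "C \<in> {1..p} \<rightarrow> carrier_mat m m"
    and B: "B \<in> {1..p} \<rightarrow> carrier_mat n n" and D: "D \<in> {1..p} \<rightarrow> carrier_mat n n"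
    and X: "X \<in> {1..p} \<rightarrow> carrier_mat m n" and Y: "Y \<in> {1..p} \<rightarrow> carrier_mat m n"
    and A': "\<Delta>A \<in> {1..p} \<rightarrow> carrier_mat m m" and C': "\<Delta>C \<in> {1..p} \<rightarrow> carrier_mat m m"
    and B': "\<Delta>B \<in> {1..p} \<rightarrow> carrier_mat n n" and D': "\<Delta>D \<in> {1..p} \<rightarrow> carrier_mat n n"
    and E': "\<Delta>E \<in> {1..p} \<rightarrow> carrier_mat m n" and F': "\<Delta>F \<in> {1..p} \<rightarrow> carrier_mat m n"
    and pos: "\<And>k. k \<in> {1..p} \<Longrightarrow> \<alpha> k > 0 \<and> \<beta> k > 0 \<and> \<gamma> k > 0 \<and> \<zeta> k > 0 \<and> \<tau> k > 0 \<and> \<delta> k > 0"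
    and eq: "pgcs_eq p A B C D E F X Y" and inv: "invertible_mat W"
    and small: "spec_norm (Winv * \<Delta>W) < 1"
    by fact+
  define N where "N = 2 * p * m * n"
  define M where "M = p * (2 * (m * m + n * n + m * n))"
  define h where "h = H1 *\<^sub>v u"
  have W_carrier: "W \<in> carrier_mat N N"
    unfolding W N_def by (rule pgcs_mat_carrier[OF A C B D])
  have V_carrier: "\<Delta>W \<in> carrier_mat N N"
    unfolding \<Delta>W N_def by (rule pgcs_mat_carrier[OF A' C' B' D'])
  have Winv_carrier: "Winv \<in> carrier_mat N N" and Winv_W: "Winv * W = 1\<^sub>m N"
    unfolding Winv using the_mat_inverse[OF W_carrier inv] by auto
  have nz: "\<alpha> k \<noteq> 0 \<and> \<beta> k \<noteq> 0 \<and> \<gamma> k \<noteq> 0 \<and> \<zeta> k \<noteq> 0 \<and> \<tau> k \<noteq> 0 \<and> \<delta> k \<noteq> 0"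
    if "k \<in> {1..p}" for k
    using pos[OF that] by simp
  note H = pgcs_H_carrier_and_mult_pgcs_u[OF X Y A' C' B' D' E' F']
  have H1_carrier: "H1 \<in> carrier_mat N M"
    unfolding H1 N_def M_def by (rule H(1)) (rule nz)
  have u_carrier: "u \<in> carrier_vec M"
    unfolding u M_def by (rule H(2)) (rule nz)
  have h_carrier: "h \<in> carrier_vec N"
    unfolding h_def by (rule mult_mat_vec_carrier[OF H1_carrier u_carrier])
  have h: "h = vectorize (interleave_cols p m (\<lambda>k. \<Delta>A k * X k - Y k * \<Delta>B k - \<Delta>E k)
      (\<lambda>k. \<Delta>C k * X (cyc_suc p k) - Y k * \<Delta>D k - \<Delta>F k))"
    unfolding h_def H1 u by (rule H(3)) (rule nz)
  have S_iff: "(X', Y') \<in> S \<longleftrightarrow> (W + \<Delta>W) *\<^sub>v vectorize (interleave_cols p m X' Y') = - h"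
    if "X' \<in> {1..p} \<rightarrow>\<^sub>E carrier_mat m n" "Y' \<in> {1..p} \<rightarrow>\<^sub>E carrier_mat m n" for X' Y'
    unfolding S W \<Delta>W h
    by (rule perturbed_solutions_iff[OF A C B D X Y A' C' B' D' E' F' eq that])
  have S_PiE: "X' \<in> {1..p} \<rightarrow>\<^sub>E carrier_mat m n" "Y' \<in> {1..p} \<rightarrow>\<^sub>E carrier_mat m n"
    if "(X', Y') \<in> S" for X' Y'
    using that unfolding S perturbed_solutions_def by auto
  have PiE_Pi: "f \<in> {1..p} \<rightarrow> carrier_mat m n" if "f \<in> {1..p} \<rightarrow>\<^sub>E carrier_mat m n" for f :: "nat \<Rightarrow> real mat"
    using that by (simp add: PiE_def)
  have z_carrier: "vectorize (interleave_cols p m X' Y') \<in> carrier_vec N"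
    if "(X', Y') \<in> S" for X' Y'
    using vectorize_carrier[OF interleave_cols_carrier[OF PiE_Pi PiE_Pi, OF S_PiE[OF that]]]
    by (simp add: N_def ac_simps)
  have "- h \<in> carrier_vec N"
    using h_carrier by simp
  note ex1 = perturbed_system_ex1[OF W_carrier Winv_carrier V_carrier Winv_W small this]
  then obtain z where z: "z \<in> carrier_vec N" "(W + \<Delta>W) *\<^sub>v z = - h"
    by blast
  \<comment> \<open>Surjectivity of stacking supplies existence: the vector solution
    \<open>z\<close> comes from some pair of matrix families.\<close>
  obtain X0 Y0 where XY0: "X0 \<in> {1..p} \<rightarrow>\<^sub>E carrier_mat m n" "Y0 \<in> {1..p} \<rightarrow>\<^sub>E carrier_mat m n"
      "z = vectorize (interleave_cols p m X0 Y0)"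
    using z(1) unfolding N_def by (rule vectorize_interleave_cols_surj)
  have ex1_S: "\<exists>!Z. Z \<in> S"
  proof (rule ex1I[of _ "(X0, Y0)"])
    show XY0_S: "(X0, Y0) \<in> S"
      using S_iff[OF XY0(1,2)] z(2) XY0(3) by simp
    fix Z assume "Z \<in> S"
    then obtain X' Y' where Z: "Z = (X', Y')" and "(X', Y') \<in> S"
      by (cases Z) auto
    note XY' = S_PiE[OF this(2)]
    have "vectorize (interleave_cols p m X' Y') = z"
      using ex1 z z_carrier[OF \<open>(X', Y') \<in> S\<close>] S_iff[OF XY'] \<open>(X', Y') \<in> S\<close> by blast
    then have "\<forall>k\<in>{1..p}. X' k = X0 k \<and> Y' k = Y0 k"
      unfolding XY0(3) vectorize_interleave_cols_eq_iff[OF PiE_Pi PiE_Pi PiE_Pi PiE_Pi, OF XY' XY0(1,2)] .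
    \<comment> \<open>Agreement on \<open>{1..p}\<close> becomes equality of functions because all
      four families are extensional.\<close>
    then show "Z = (X0, Y0)"
      unfolding Z using XY' XY0(1,2) by (auto intro: PiE_ext)
  qed
  define s where "s = spec_norm (Winv * \<Delta>W)"
  define t where "t = (\<Sum>i = 1..p. (frob_norm (\<Delta>A i))\<^sup>2 / (\<alpha> i)\<^sup>2 + (frob_norm (\<Delta>B i))\<^sup>2 / (\<beta> i)\<^sup>2
                              + (frob_norm (\<Delta>E i))\<^sup>2 / (\<gamma> i)\<^sup>2 + (frob_norm (\<Delta>C i))\<^sup>2 / (\<zeta> i)\<^sup>2
                              + (frob_norm (\<Delta>D i))\<^sup>2 / (\<tau> i)\<^sup>2 + (frob_norm (\<Delta>F i))\<^sup>2 / (\<delta> i)\<^sup>2)"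
  have WH: "Winv * H1 *\<^sub>v u = Winv *\<^sub>v h"
    unfolding h_def by (rule assoc_mult_mat_vec[OF Winv_carrier H1_carrier u_carrier])
  have s: "0 < 1 - s"
    using small by (simp add: s_def)
  have bound1: "frob_norm (interleave_cols p m X' Y') \<le> vec_norm2 (Winv * H1 *\<^sub>v u) / (1 - s)"
    if "(X', Y') \<in> S" for X' Y'
    using perturbed_system_norm_bound[OF W_carrier Winv_carrier V_carrier Winv_W small
        z_carrier[OF that] h_carrier] S_iff[OF S_PiE[OF that]] that
    unfolding vec_norm2_vectorize WH s_def by blast
  have norm_u: "vec_norm2 u = sqrt t"
    unfolding t_def vec_norm2_pgcs_u_power2[symmetric] u by simp
  have "vec_norm2 (Winv * H1 *\<^sub>v u) \<le> spec_norm (Winv * H1) * sqrt t"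
    using vec_norm2_mult_mat_vec_le[OF mult_carrier_mat[OF Winv_carrier H1_carrier] u_carrier]
    by (simp only: norm_u)
  then have bound2: "vec_norm2 (Winv * H1 *\<^sub>v u) / (1 - s) \<le> spec_norm (Winv * H1) * sqrt t / (1 - s)"
    using s by (intro divide_right_mono) auto
  let ?Q = "\<lambda>k. {frob_norm (\<Delta>A k) / \<alpha> k, frob_norm (\<Delta>B k) / \<beta> k,
                            frob_norm (\<Delta>E k) / \<gamma> k, frob_norm (\<Delta>C k) / \<zeta> k,
                            frob_norm (\<Delta>D k) / \<tau> k, frob_norm (\<Delta>F k) / \<delta> k}"
  have Q: "q \<le> \<epsilon>" "0 \<le> q" if k: "k \<in> {1..p}" and q: "q \<in> ?Q k" for k q
  proof -
    have "q \<le> Max (?Q k)"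
      using q by (intro Max_ge) auto
    also have "\<dots> \<le> \<epsilon>"
      unfolding \<epsilon> using k by (intro Max_ge finite_imageI finite_atLeastAtMost imageI)
    finally show "q \<le> \<epsilon>" .
    have "0 \<le> frob_norm G" for G
      by (simp add: frob_norm_def)
    then show "0 \<le> q"
      using q pos[OF k] by auto
  qed
  \<comment> \<open>Since \<open>p\<close> is at least 1, index 1 provides a nonnegative quotient
    below the maximum. The sign is needed to replace the square root of
    \<open>\<epsilon>\<^sup>2\<close> by \<open>\<epsilon>\<close>.\<close>
  have eps: "0 \<le> \<epsilon>"
    using Q[of 1 "frob_norm (\<Delta>A 1) / \<alpha> 1"] p by force
  \<comment> \<open>The factor \<open>6 * p\<close> under the root counts the squared quotients, six
    for each index, each at most \<open>\<epsilon>\<^sup>2\<close>.\<close>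
  have "t \<le> (\<Sum>i = 1..p. 6 * \<epsilon>\<^sup>2)"
    unfolding t_def
  proof (rule sum_mono)
    fix i assume i: "i \<in> {1..p}"
    have "q\<^sup>2 \<le> \<epsilon>\<^sup>2" if "q \<in> ?Q i" for q
      using Q[OF i that] by (rule power_mono)
    from this[of "frob_norm (\<Delta>A i) / \<alpha> i"] this[of "frob_norm (\<Delta>B i) / \<beta> i"]
      this[of "frob_norm (\<Delta>E i) / \<gamma> i"] this[of "frob_norm (\<Delta>C i) / \<zeta> i"]
      this[of "frob_norm (\<Delta>D i) / \<tau> i"] this[of "frob_norm (\<Delta>F i) / \<delta> i"]
    show "(frob_norm (\<Delta>A i))\<^sup>2 / (\<alpha> i)\<^sup>2 + (frob_norm (\<Delta>B i))\<^sup>2 / (\<beta> i)\<^sup>2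
        + (frob_norm (\<Delta>E i))\<^sup>2 / (\<gamma> i)\<^sup>2 + (frob_norm (\<Delta>C i))\<^sup>2 / (\<zeta> i)\<^sup>2
        + (frob_norm (\<Delta>D i))\<^sup>2 / (\<tau> i)\<^sup>2 + (frob_norm (\<Delta>F i))\<^sup>2 / (\<delta> i)\<^sup>2 \<le> 6 * \<epsilon>\<^sup>2"
      unfolding power_divide by simp
  qed
  then have "sqrt t \<le> sqrt (6 * real p * \<epsilon>\<^sup>2)"
    by (intro real_sqrt_le_mono) (simp add: ac_simps)
  also have "\<dots> = sqrt (6 * real p) * \<epsilon>"
    using eps by (simp add: real_sqrt_mult)
  finally have "spec_norm (Winv * H1) * sqrt t \<le> spec_norm (Winv * H1) * (sqrt (6 * real p) * \<epsilon>)"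
    by (rule mult_left_mono[OF _ spec_norm_nonneg])
  then have bound3: "spec_norm (Winv * H1) * sqrt t / (1 - s) \<le> sqrt (6 * real p) * spec_norm (Winv * H1) * \<epsilon> / (1 - s)"
    using s by (intro divide_right_mono) (simp_all add: ac_simps)
  show ?thesis
    \<comment> \<open>The last estimate of the theorem is the chain of all three bounds, since
      \<open>bound3\<close> only compares the two right-hand sides.\<close>
    using ex1_S bound1 bound2 order_trans[OF bound1 order_trans[OF bound2 bound3]]
    unfolding s_def t_def by blast
qed

end
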